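(* Let $G$ be a GBS group, and let $\phi\in\operatorname{Aut}(G)$ be of finite order. Then $\operatorname{Fix}(\phi)$ is finitely generated.
   Context: A generalised Baumslag-Solitar (GBS) group is a finitely generated group $G$ admitting an action on a tree $T$ (as usual in Bass-Serre theory, by graph automorphisms without edge inversions) in which all edge and vertex stabilisers are infinite cyclic. $\operatorname{Fix}(\phi)=\{g\in G\mid\phi(g)=g\}$. *)

theory Defs
  imports
    "HOL-Algebra.Algebra"
    "Graph_Theory.Bidirected_Digraph"
    "Graph_Theory.Digraph_Component"
begin

section \<open>Trees in the sense of Serre\<close>

text \<open>
  Bidirected digraphs are graphs in the sense of Serre: \<open>arev\<close> is a fixed-point-free involution
  of the arcs which exchanges tail and head, and a geometric edge is a pair \<open>{a, arev a}\<close>.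
  Loops, multiple edges and infinite graphs are allowed.  The predicates \<open>forest\<close> and
  \<open>tree\<close> of the digraph library are not applicable here, since \<open>[a, arev a]\<close> is a \<open>cycle\<close> for
  every arc \<open>a\<close> that is not a loop; these are the only cycles that have to be disregarded.
  Connectedness of \<open>T\<close> includes that \<open>T\<close> has a vertex.
\<close>

locale serre_tree = bidirected_digraph T arev
  for T :: "('v, 'e) pre_digraph" and arev :: "'e \<Rightarrow> 'e" +
  assumes connected: "Digraph_Component.connected T"
    and no_circuit: "pre_digraph.cycle T p \<Longrightarrow> \<exists>a \<in> arcs T. p = [a, arev a]"

section \<open>Actions on trees by graph automorphisms without edge inversions\<close>

locale tree_action =
  serre_tree T arev +
  V: group_action G "verts T" \<alpha> +
  E: group_action G "arcs T" \<beta>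
  for G :: "('g, 'b) monoid_scheme"
    and T :: "('v, 'e) pre_digraph" and arev :: "'e \<Rightarrow> 'e"
    and \<alpha> :: "'g \<Rightarrow> 'v \<Rightarrow> 'v" and \<beta> :: "'g \<Rightarrow> 'e \<Rightarrow> 'e" +
  assumes tail_equivariant:
      "\<lbrakk>g \<in> carrier G; a \<in> arcs T\<rbrakk> \<Longrightarrow> tail T (\<beta> g a) = \<alpha> g (tail T a)"
    and head_equivariant:
      "\<lbrakk>g \<in> carrier G; a \<in> arcs T\<rbrakk> \<Longrightarrow> head T (\<beta> g a) = \<alpha> g (head T a)"
    and arev_equivariant:
      "\<lbrakk>g \<in> carrier G; a \<in> arcs T\<rbrakk> \<Longrightarrow> \<beta> g (arev a) = arev (\<beta> g a)"
    and no_inversion: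
      "\<lbrakk>g \<in> carrier G; a \<in> arcs T\<rbrakk> \<Longrightarrow> \<beta> g a \<noteq> arev a"

section \<open>Generalised Baumslag-Solitar groups\<close>

definition finitely_generated :: "('g, 'b) monoid_scheme \<Rightarrow> bool" where
  "finitely_generated G \<longleftrightarrow> (\<exists>S. finite S \<and> S \<subseteq> carrier G \<and> generate G S = carrier G)"

definition infinite_cyclic :: "('g, 'b) monoid_scheme \<Rightarrow> bool" where
  "infinite_cyclic G \<longleftrightarrow> cyclic_group G \<and> infinite (carrier G)"

text \<open>
  HOL cannot quantify existentially over types, so the types of the vertices and of the arcs of
  the tree are parameters.  A theorem assuming \<open>gbs_group TYPE('v) TYPE('e) G\<close> with type
  variables \<open>'v\<close> and \<open>'e\<close> that do not occur elsewhere covers trees over arbitrary types.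
  As there are no inversions, the stabiliser of the arc \<open>a\<close> is also the stabiliser of the
  geometric edge \<open>{a, arev a}\<close>.
\<close>

definition gbs_group :: "'v itself \<Rightarrow> 'e itself \<Rightarrow> ('g, 'b) monoid_scheme \<Rightarrow> bool" where
  "gbs_group TYPE('v) TYPE('e) G \<longleftrightarrow>
     group G \<and> finitely_generated G \<and>
     (\<exists>(T :: ('v, 'e) pre_digraph) arev \<alpha> \<beta>.
        tree_action G T arev \<alpha> \<beta> \<and>
        (\<forall>v \<in> verts T. infinite_cyclic (G\<lparr>carrier := stabilizer G \<alpha> v\<rparr>)) \<and>
        (\<forall>a \<in> arcs T. infinite_cyclic (G\<lparr>carrier := stabilizer G \<beta> a\<rparr>)))"

section \<open>Fixed subgroups\<close>

definition Fix :: "('g, 'b) monoid_scheme \<Rightarrow> ('g \<Rightarrow> 'g) \<Rightarrow> 'g set" where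
  "Fix G \<phi> = {g \<in> carrier G. \<phi> g = g}"

end

theory Submission
  imports Defs "HOL-Library.Sublist"
begin

text \<open>
  Let \<open>G\<close> act on a tree with infinite cyclic stabilisers, let \<open>x\<close> be a vertex with stabiliser
  \<open>K = \<langle>a\<rangle>\<close>, and put \<open>dist g h = d(g x, h x)\<close>.  This left invariant pseudometric on \<open>G\<close> is
  0-hyperbolic.  As \<open>G\<close> is finitely generated and arc stabilisers have finite index in vertex
  stabilisers, every ball around \<open>\<one>\<close> is a finite union of cosets \<open>s K\<close>.  Everything after the
  construction of this length function only uses these facts.  They imply that \<open>K\<close> is commensurated
  by \<open>G\<close>: every \<open>g\<close> conjugates some nonzero power of \<open>a\<close> to a nonzero power of \<open>a\<close>.

  The proof distinguishes whether a positive power of \<open>\<phi> a\<close> lies in \<open>K\<close>.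

  If so, then \<open>\<phi>\<close> is bounded on balls, and so is its inverse, which is an iterate of \<open>\<phi>\<close>.  Such
  a coarse embedding satisfies bounded cancellation (\<open>bounded_cancellation\<close>): it maps points near a
  geodesic to points near the geodesic between the images of its ends.  Let \<open>h\<close> be fixed by \<open>\<phi>\<close> and
  let \<open>g\<close> be near the geodesic from \<open>\<one>\<close> to \<open>h\<close>.  Then \<open>\<phi> g\<close> is near this geodesic too, so
  that \<open>g\<close> and \<open>\<phi> g\<close> are coarsely comparable along it, and \<open>\<phi>\<close> coarsely preserves the order.
  A coarsely monotone map of finite order moves points by a bounded amount
  (\<open>periodic_displacement_bounded\<close>); so \<open>dist g (\<phi> g) \<le> R\<close> with \<open>R\<close> independent of \<open>g\<close> and \<open>h\<close>.
  The elements with \<open>dist g (\<phi> g) \<le> R\<close> lie in finitely many double cosets of \<open>Fix \<phi>\<close> and \<open>K\<close>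
  (\<open>small_displacement_cofinite\<close>): the cocycle value \<open>inv g \<otimes> \<phi> g\<close> determines the coset
  \<open>Fix \<phi> \<otimes> g\<close>, the values lie in finitely many cosets of \<open>K\<close>, and in each of them the finite order
  of \<open>\<phi>\<close> leaves finitely many values up to right multiplication of \<open>g\<close> by \<open>K\<close>.
  Following a chain of points along the geodesic from \<open>\<one>\<close> to \<open>h\<close>, one writes \<open>h\<close> as a product of
  elements of \<open>Fix \<phi>\<close> of bounded length; these meet finitely many cosets of \<open>K\<close>, and
  \<open>Fix \<phi> \<inter> K\<close> is cyclic.

  If no positive power of \<open>b = \<phi> a\<close> lies in \<open>K\<close>, then \<open>b\<close> is hyperbolic.  By transport along \<open>\<phi>\<close>
  also \<open>\<langle>b\<rangle>\<close> is commensurated, and comparing translation lengths one finds that for some \<open>m > 0\<close> the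
  power \<open>c = b^m\<close> is conjugate only to \<open>c\<close> and its inverse.  Hence all points of the orbit are moved
  equally far by each power of \<open>c\<close>, which keeps the orbit in a bounded neighbourhood of the axis of
  \<open>c\<close> (\<open>near_axis\<close>).  So \<open>G\<close> is covered by finitely many cosets of the product of the normal
  subgroups \<open>\<langle>c\<rangle>\<close> and \<open>\<langle>a^m\<rangle>\<close>.  This product is polycyclic, and hence all subgroups of \<open>G\<close> are
  finitely generated.
\<close>

section \<open>Finitely generated subgroups\<close>

context group
begin

lemma mult_inv_cancel_left: "\<lbrakk>x \<in> carrier G; y \<in> carrier G\<rbrakk> \<Longrightarrow> x \<otimes> (inv x \<otimes> y) = y"
  by (simp add: m_assoc[symmetric])

lemma inv_mult_cancel_left: "\<lbrakk>x \<in> carrier G; y \<in> carrier G\<rbrakk> \<Longrightarrow> inv x \<otimes> (x \<otimes> y) = y"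
  by (simp add: m_assoc[symmetric])

lemmas free_reduce = m_assoc inv_mult_group mult_inv_cancel_left inv_mult_cancel_left

lemma finitely_generated_subgroupI:
  assumes "subgroup H G" "finite S" "S \<subseteq> H" "H \<subseteq> generate G S"
  shows "finitely_generated (G\<lparr>carrier := H\<rparr>)"
proof -
  have "generate G S \<subseteq> H"
    by (rule generate_subgroup_incl[OF assms(3,1)])
  then have "generate (G\<lparr>carrier := H\<rparr>) S = H"
    using generate_consistent[OF assms(3,1)] assms(4) by blast
  then show ?thesis
    unfolding finitely_generated_def using assms(2,3) by auto
qed

lemma finitely_generated_subgroupE:
  assumes "subgroup H G" "finitely_generated (G\<lparr>carrier := H\<rparr>)"
  obtains S where "finite S" "S \<subseteq> H" "generate G S = H"
proof -
  obtain S where "finite S" "S \<subseteq> H" "generate (G\<lparr>carrier := H\<rparr>) S = H"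
    using assms(2) unfolding finitely_generated_def by auto
  then show ?thesis
    using that generate_consistent[OF _ assms(1)] by auto
qed

text \<open>
  Besides generators of \<open>H \<inter> N\<close>, one element of \<open>Y\<close> from every coset of \<open>N\<close> that meets \<open>Y\<close>
  suffices.
\<close>

lemma finitely_generated_by_cosets:
  assumes H: "subgroup H G" and N: "subgroup N G"
    and fin: "finite S" and S: "S \<subseteq> carrier G"
    and gens: "Y \<subseteq> H" "H \<subseteq> generate G Y"
    and cosets: "\<And>x. x \<in> Y \<Longrightarrow> \<exists>s\<in>S. inv s \<otimes> x \<in> N"
    and fg: "finitely_generated (G\<lparr>carrier := H \<inter> N\<rparr>)"
  shows "finitely_generated (G\<lparr>carrier := H\<rparr>)"
proof -
  have HN: "subgroup (H \<inter> N) G" using H N by (rule subgroups_Inter_pair)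
  obtain F where F: "finite F" "F \<subseteq> H \<inter> N" "generate G F = H \<inter> N"
    using finitely_generated_subgroupE[OF HN fg] .
  have XG: "Y \<subseteq> carrier G" using gens(1) subgroup.subset[OF H] by blast
  define r where "r s = (SOME x. x \<in> Y \<and> inv s \<otimes> x \<in> N)" for s
  define S' where "S' = {s \<in> S. \<exists>x\<in>Y. inv s \<otimes> x \<in> N}"
  have r: "r s \<in> Y \<and> inv s \<otimes> r s \<in> N" if "s \<in> S'" for s
    unfolding r_def by (rule someI_ex) (use that in \<open>auto simp: S'_def\<close>)
  define B where "B = r ` S' \<union> F"
  have BH: "B \<subseteq> H" using r gens(1) F(2) by (auto simp: B_def)
  have BG: "B \<subseteq> carrier G" using BH subgroup.subset[OF H] by blast
  have "x \<in> generate G B" if x: "x \<in> Y" for x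
  proof -
    obtain s where s: "s \<in> S" "inv s \<otimes> x \<in> N" using cosets[OF x] by blast
    then have s': "s \<in> S'" using x by (auto simp: S'_def)
    have c: "s \<in> carrier G" "x \<in> carrier G" "r s \<in> carrier G"
      using s S x XG r[OF s'] by auto
    have "inv (inv s \<otimes> r s) \<otimes> (inv s \<otimes> x) \<in> N"
      using subgroup.m_closed[OF N] subgroup.m_inv_closed[OF N] r[OF s'] s by blast
    also have "inv (inv s \<otimes> r s) \<otimes> (inv s \<otimes> x) = inv (r s) \<otimes> x"
      using c by (simp add: free_reduce)
    finally have "inv (r s) \<otimes> x \<in> N" .
    moreover have "inv (r s) \<otimes> x \<in> H"
      using subgroup.m_closed[OF H] subgroup.m_inv_closed[OF H] r[OF s'] x gens(1) by blast
    ultimately have "inv (r s) \<otimes> x \<in> generate G F" using F(3) by blast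
    then have "inv (r s) \<otimes> x \<in> generate G B"
      using mono_generate[of F B] by (auto simp: B_def)
    moreover have "r s \<in> generate G B" using s' by (auto simp: B_def intro: generate.incl)
    ultimately have "r s \<otimes> (inv (r s) \<otimes> x) \<in> generate G B" by (rule generate.eng[rotated])
    then show ?thesis using c by (simp add: free_reduce)
  qed
  then have "generate G Y \<subseteq> generate G B"
    by (intro generate_subgroup_incl) (use generate_is_subgroup[OF BG] in auto)
  moreover have "finite B" using fin F(1) by (auto simp: B_def S'_def)
  ultimately show ?thesis
    using finitely_generated_subgroupI[OF H _ BH] gens(2) by blast
qed

lemma conj_int_pow_closed:
  assumes U: "subgroup U G" and t: "t \<in> carrier G"
    and norm: "\<And>u. u \<in> U \<Longrightarrow> t \<otimes> u \<otimes> inv t \<in> U" "\<And>u. u \<in> U \<Longrightarrow> inv t \<otimes> u \<otimes> t \<in> U"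
    and u: "u \<in> U"
  shows "t [^] (i::int) \<otimes> u \<otimes> inv (t [^] i) \<in> U"
proof -
  have UG: "\<And>u. u \<in> U \<Longrightarrow> u \<in> carrier G" using subgroup.subset[OF U] by blast
  have pos: "t [^] n \<otimes> u \<otimes> inv (t [^] n) \<in> U" for n :: nat
  proof (induction n)
    case 0
    then show ?case using u UG by simp
  next
    case (Suc n)
    have "t [^] Suc n \<otimes> u \<otimes> inv (t [^] Suc n)
        = t \<otimes> (t [^] n \<otimes> u \<otimes> inv (t [^] n)) \<otimes> inv t"
      unfolding nat_pow_Suc2[OF t] using t UG[OF u] by (simp add: free_reduce)
    then show ?case using norm(1)[OF Suc] by simp
  qed
  have neg: "inv (t [^] n) \<otimes> u \<otimes> t [^] n \<in> U" for n :: nat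
  proof (induction n)
    case 0
    then show ?case using u UG by simp
  next
    case (Suc n)
    have "inv (t [^] Suc n) \<otimes> u \<otimes> (t [^] Suc n)
        = inv t \<otimes> (inv (t [^] n) \<otimes> u \<otimes> t [^] n) \<otimes> t"
      using t UG[OF u] by (simp add: free_reduce)
    then show ?case using norm(2)[OF Suc] by simp
  qed
  show ?thesis
    using pos neg t by (cases i rule: int_cases2) (simp_all add: int_pow_int int_pow_neg_int)
qed

text \<open>
  Besides generators of \<open>H \<inter> U\<close>, one element whose exponent of \<open>t\<close> generates the group of all
  exponents occurring in \<open>H\<close> suffices.  So the property that all subgroups are finitely generated
  passes to extensions with cyclic quotient.
\<close>

lemma finitely_generated_cyclic_extension:
  assumes U: "subgroup U G" and t: "t \<in> carrier G"
    and norm: "\<And>u. u \<in> U \<Longrightarrow> t \<otimes> u \<otimes> inv t \<in> U" "\<And>u. u \<in> U \<Longrightarrow> inv t \<otimes> u \<otimes> t \<in> U"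
    and noeth: "\<And>H. subgroup H G \<Longrightarrow> H \<subseteq> U \<Longrightarrow> finitely_generated (G\<lparr>carrier := H\<rparr>)"
    and H: "subgroup H G" and HV: "\<And>h. h \<in> H \<Longrightarrow> \<exists>i::int. \<exists>u\<in>U. h = t [^] i \<otimes> u"
  shows "finitely_generated (G\<lparr>carrier := H\<rparr>)"
proof -
  have UG: "\<And>u. u \<in> U \<Longrightarrow> u \<in> carrier G" using subgroup.subset[OF U] by blast
  have HG: "\<And>u. u \<in> H \<Longrightarrow> u \<in> carrier G" using subgroup.subset[OF H] by blast
  define V where "V i x \<longleftrightarrow> (\<exists>u\<in>U. x = t [^] i \<otimes> u)" for i :: int and x
  have Vmult: "V (i + j) (x \<otimes> y)" if "V i x" "V j y" for i j x y
  proof -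
    obtain u v where u: "u \<in> U" "x = t [^] i \<otimes> u" and v: "v \<in> U" "y = t [^] j \<otimes> v"
      using \<open>V i x\<close> \<open>V j y\<close> V_def by auto
    let ?w = "t [^] (- j) \<otimes> u \<otimes> inv (t [^] (- j))"
    have "?w \<in> U" by (rule conj_int_pow_closed[OF U t norm u(1)])
    then have "?w \<otimes> v \<in> U" using v subgroup.m_closed[OF U] by blast
    moreover have "x \<otimes> y = t [^] (i + j) \<otimes> (?w \<otimes> v)"
      using u v UG t by (simp add: int_pow_mult int_pow_neg free_reduce)
    ultimately show ?thesis unfolding V_def by blast
  qed
  have Vinv: "V (- i) (inv x)" if "V i x" for i x
  proof -
    obtain u where u: "u \<in> U" "x = t [^] i \<otimes> u"
      using \<open>V i x\<close> V_def by auto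
    let ?w = "t [^] i \<otimes> inv u \<otimes> inv (t [^] i)"
    have "?w \<in> U" by (rule conj_int_pow_closed[OF U t norm subgroup.m_inv_closed[OF U u(1)]])
    moreover have "inv x = t [^] (- i) \<otimes> ?w"
      using u UG t by (simp add: int_pow_neg free_reduce)
    ultimately show ?thesis unfolding V_def by blast
  qed
  have V0: "V 0 x \<longleftrightarrow> x \<in> U" for x
    unfolding V_def using UG by auto
  have Vpow: "V (i * int n) (x [^] n)" if "V i x" for i x n
  proof (induction n)
    case 0
    then show ?case using V0 subgroup.one_closed[OF U] by simp
  next
    case (Suc n)
    then show ?case using Vmult[OF Suc that] by (simp add: algebra_simps)
  qed
  have Vipow: "V (i * k) (x [^] k)" if "V i x" "x \<in> carrier G" for i x and k :: int
    using Vpow[OF that(1)] Vinv[OF Vpow[OF that(1)]] that(2)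
    by (cases k rule: int_cases2) (simp_all add: int_pow_int int_pow_neg_int)
  have HU: "subgroup (H \<inter> U) G" using H U by (rule subgroups_Inter_pair)
  obtain S where S: "finite S" "S \<subseteq> H \<inter> U" "generate G S = H \<inter> U"
    using finitely_generated_subgroupE[OF HU noeth[OF HU]] by blast
  define I where "I = {n::nat. n > 0 \<and> (\<exists>h\<in>H. V (int n) h)}"
  show ?thesis
  proof (cases "I = {}")
    case True
    have "H \<subseteq> U"
    proof
      fix h assume h: "h \<in> H"
      then obtain i where i: "V i h" using HV unfolding V_def by blast
      have "\<not> i > 0"
      proof
        assume "i > 0"
        then have "nat i \<in> I" using i h by (auto simp: I_def)
        then show False using True by blast
      qed
      moreover have "\<not> i < 0"
      proof
        assume "i < 0"
        then have "nat (- i) \<in> I"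
          using Vinv[OF i] subgroup.m_inv_closed[OF H h] by (auto simp: I_def)
        then show False using True by blast
      qed
      ultimately show "h \<in> U" using i V0 by (metis linorder_neqE_linordered_idom)
    qed
    then show ?thesis using noeth[OF H] by blast
  next
    case False
    define m where "m = (LEAST n. n \<in> I)"
    have m: "m \<in> I" unfolding m_def using False by (meson LeastI all_not_in_conv)
    have mleast: "m \<le> n" if "n \<in> I" for n unfolding m_def using that by (rule Least_le)
    obtain e where e: "e \<in> H" "V (int m) e" and mpos: "m > 0" using m by (auto simp: I_def)
    have "H \<subseteq> generate G (insert e S)"
    proof
      fix h assume h: "h \<in> H"
      then obtain i where i: "V i h" using HV unfolding V_def by blast
      define y where "y = inv (e [^] (i div int m)) \<otimes> h"
      have eH: "e [^] k \<in> H" for k :: int using subgroup_int_pow_closed[OF H e(1)] .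
      have yH: "y \<in> H" unfolding y_def
        using subgroup.m_closed[OF H] subgroup.m_inv_closed[OF H] eH h by blast
      have "V (- (int m * (i div int m)) + i) y" unfolding y_def
        by (intro Vmult Vinv Vipow e i HG)
      moreover have "- (int m * (i div int m)) + i = i mod int m"
        by (simp add: minus_mult_div_eq_mod algebra_simps)
      ultimately have y: "V (i mod int m) y" by simp
      have "i mod int m = 0"
      proof (rule ccontr)
        assume "i mod int m \<noteq> 0"
        then have "nat (i mod int m) \<in> I"
          using y yH mpos pos_mod_sign[of "int m" i] by (auto simp: I_def intro!: bexI[of _ y])
        then have "m \<le> nat (i mod int m)" by (rule mleast)
        then show False using mpos pos_mod_bound[of "int m" i] by linarith
      qed
      then have "y \<in> H \<inter> U" using y V0 yH by simp
      then have "y \<in> generate G (insert e S)" using S(3) mono_generate[of S "insert e S"] by blast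
      moreover have "e [^] (i div int m) \<in> generate G (insert e S)"
      proof -
        have "subgroup (generate G (insert e S)) G"
          by (rule generate_is_subgroup) (use e S HG in auto)
        then show ?thesis by (rule subgroup_int_pow_closed) (auto intro: generate.incl)
      qed
      ultimately have "e [^] (i div int m) \<otimes> y \<in> generate G (insert e S)"
        by (rule generate.eng[rotated])
      also have "e [^] (i div int m) \<otimes> y = h"
        unfolding y_def using HG e h by (simp add: free_reduce)
      finally show "h \<in> generate G (insert e S)" .
    qed
    then show ?thesis
      by (intro finitely_generated_subgroupI[OF H, of "insert e S"]) (use S e in auto)
  qed
qed

lemma finitely_generated_subgroup_cyclic:
  assumes t: "t \<in> carrier G" and H: "subgroup H G" and HV: "H \<subseteq> range (\<lambda>i::int. t [^] i)"
  shows "finitely_generated (G\<lparr>carrier := H\<rparr>)"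
proof (rule finitely_generated_cyclic_extension[where U = "{\<one>}" and t = t])
  show "finitely_generated (G\<lparr>carrier := H\<rparr>)" if "subgroup H G" "H \<subseteq> {\<one>}" for H
    by (rule finitely_generated_subgroupI[OF that(1), of "{}"])
      (use that in \<open>auto intro: generate.one\<close>)
  show "\<exists>i::int. \<exists>u\<in>{\<one>}. h = t [^] i \<otimes> u" if "h \<in> H" for h
    using that HV t by auto
qed (use t H in \<open>auto intro: triv_subgroup\<close>)

end

section \<open>Lyndon length functions\<close>

text \<open>
  The axioms of the function \<open>g \<mapsto> d(x, g x)\<close> for an action on a tree.  The expression
  \<open>len x + len y - len (inv x \<otimes> y)\<close> is twice the Gromov product; it is not halved, so that all
  lengths remain integers.
\<close>

locale lyndon_length = group G for G :: "('g, 'b) monoid_scheme" (structure) +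
  fixes len :: "'g \<Rightarrow> int"
  assumes len_one: "len \<one> = 0"
    and len_inv: "g \<in> carrier G \<Longrightarrow> len (inv g) = len g"
    and len_mult: "\<lbrakk>g \<in> carrier G; h \<in> carrier G\<rbrakk> \<Longrightarrow> len (g \<otimes> h) \<le> len g + len h"
    and len_hyperbolic: "\<lbrakk>x \<in> carrier G; y \<in> carrier G; z \<in> carrier G\<rbrakk> \<Longrightarrow>
        min (len x + len y - len (inv x \<otimes> y)) (len y + len z - len (inv y \<otimes> z))
          \<le> len x + len z - len (inv x \<otimes> z)"
begin

definition dist :: "'g \<Rightarrow> 'g \<Rightarrow> int" where
  "dist g h = len (inv g \<otimes> h)"

lemma dist_one_left: "g \<in> carrier G \<Longrightarrow> dist \<one> g = len g"
  by (simp add: dist_def)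

lemma dist_commute: "g \<in> carrier G \<Longrightarrow> h \<in> carrier G \<Longrightarrow> dist g h = dist h g"
  using len_inv[of "inv g \<otimes> h"] by (simp add: dist_def inv_mult_group)

lemma dist_self: "g \<in> carrier G \<Longrightarrow> dist g g = 0"
  by (simp add: dist_def len_one)

lemma dist_triangle:
  assumes "x \<in> carrier G" "y \<in> carrier G" "z \<in> carrier G"
  shows "dist x z \<le> dist x y + dist y z"
proof -
  have "(inv x \<otimes> y) \<otimes> (inv y \<otimes> z) = inv x \<otimes> z"
    using assms by (simp add: free_reduce)
  then show ?thesis using len_mult[of "inv x \<otimes> y" "inv y \<otimes> z"] assms by (simp add: dist_def)
qed

lemma dist_left_mult:
  assumes "g \<in> carrier G" "x \<in> carrier G" "y \<in> carrier G"
  shows "dist (g \<otimes> x) (g \<otimes> y) = dist x y"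
  using assms by (simp add: dist_def free_reduce)

lemma dist_nonneg: "x \<in> carrier G \<Longrightarrow> y \<in> carrier G \<Longrightarrow> 0 \<le> dist x y"
  using dist_triangle[of x y x] dist_commute[of x y] dist_self[of x] by simp

lemma len_nonneg: "x \<in> carrier G \<Longrightarrow> 0 \<le> len x"
  using dist_nonneg[of \<one> x] dist_one_left by simp

text \<open>
  The hyperbolicity axiom speaks of triples seen from the base point \<open>\<one>\<close>; by left invariance
  any \<open>w\<close> may be taken as the base point.
\<close>

lemma four_point:
  assumes "x \<in> carrier G" "y \<in> carrier G" "z \<in> carrier G" "w \<in> carrier G"
  shows "dist x z + dist y w \<le> max (dist x y + dist z w) (dist x w + dist y z)"
proof -
  let ?x = "inv w \<otimes> x" and ?y = "inv w \<otimes> y" and ?z = "inv w \<otimes> z"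
  have l: "len (inv (inv w \<otimes> p) \<otimes> (inv w \<otimes> q)) = dist p q"
    if "p \<in> carrier G" "q \<in> carrier G" for p q
    using dist_left_mult[of "inv w" p q] that assms(4) by (simp add: dist_def)
  show ?thesis
    using len_hyperbolic[of ?x ?y ?z] assms
      dist_commute[of w x] dist_commute[of w y] dist_commute[of w z]
    unfolding l[OF assms(1,2)] l[OF assms(2,3)] l[OF assms(1,3)]
    by (auto simp: dist_def[of w])
qed

end

section \<open>Coarse embeddings and bounded cancellation\<close>

lemma rtrancl_crossing:
  assumes "(x, y) \<in> R\<^sup>*" "P x" "\<not> P y"
  obtains u v where "(u, v) \<in> R" "P u" "\<not> P v"
proof -
  from assms have "\<exists>u v. (u, v) \<in> R \<and> P u \<and> \<not> P v"
    by (induction rule: rtrancl_induct) blast+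
  then show ?thesis using that by blast
qed

context lyndon_length
begin

text \<open>
  In a tree \<open>dist x u + dist u y - dist x y\<close> is twice the distance from \<open>u\<close> to the geodesic from
  \<open>x\<close> to \<open>y\<close>, so this says that \<open>u\<close> is at distance at most \<open>C / 2\<close> from it.
\<close>

definition between :: "int \<Rightarrow> 'g \<Rightarrow> 'g \<Rightarrow> 'g \<Rightarrow> bool" where
  "between C x u y \<longleftrightarrow> dist x u + dist u y \<le> dist x y + C"

definition steps :: "int \<Rightarrow> 'g set \<Rightarrow> ('g \<times> 'g) set" where
  "steps D A = {(u, v). u \<in> A \<and> v \<in> A \<and> dist u v \<le> D}"

lemma four_point_cases:
  assumes "x \<in> carrier G" "y \<in> carrier G" "z \<in> carrier G" "w \<in> carrier G"
  shows "dist x z + dist y w \<le> dist x y + dist z w \<or> dist x z + dist y w \<le> dist x w + dist y z"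
  using four_point[OF assms] by (auto simp: max_def split: if_splits)

text \<open>
  The prefixes of a word in the generators form a path with bounded steps.
\<close>

lemma steps_connected:
  assumes "finite S" "S \<subseteq> carrier G" "generate G S = carrier G"
  obtains D where "D \<ge> 0"
    "\<And>x y. x \<in> carrier G \<Longrightarrow> y \<in> carrier G \<Longrightarrow> (x, y) \<in> (steps D (carrier G))\<^sup>*"
proof -
  define D where "D = (\<Sum>s\<in>S. len s)"
  have D: "len s \<le> D" if "s \<in> S" for s
    unfolding D_def by (rule member_le_sum) (use that assms len_nonneg in auto)
  have shift: "(g \<otimes> x, g \<otimes> y) \<in> (steps D (carrier G))\<^sup>*"
    if "(x, y) \<in> (steps D (carrier G))\<^sup>*" "g \<in> carrier G" for g x y
    using that(1)
  proof (induction rule: rtrancl_induct)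
    case (step y z)
    then have "(g \<otimes> y, g \<otimes> z) \<in> steps D (carrier G)"
      using that(2) by (auto simp: steps_def dist_left_mult)
    then show ?case using step.IH by simp
  qed simp
  have one: "(\<one>, g) \<in> (steps D (carrier G))\<^sup>*" if "g \<in> generate G S" for g
    using that
  proof (induction rule: generate.induct)
    case (incl h)
    then show ?case using assms(2) D[of h]
      by (intro r_into_rtrancl) (auto simp: steps_def dist_one_left)
  next
    case (inv h)
    then show ?case using assms(2) D[of h]
      by (intro r_into_rtrancl) (auto simp: steps_def dist_one_left len_inv subset_iff)
  next
    case (eng h1 h2)
    have "h1 \<in> carrier G" "h2 \<in> carrier G"
      using eng.hyps assms(2) generate_in_carrier by blast+
    then show ?case using shift[OF eng.IH(2), of h1] eng.IH(1) by simp
  qed simp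
  show ?thesis
  proof (rule that[of D])
    show "D \<ge> 0" unfolding D_def by (rule sum_nonneg) (use assms len_nonneg in auto)
    fix x y assume xy: "x \<in> carrier G" "y \<in> carrier G"
    then have "(x \<otimes> \<one>, x \<otimes> (inv x \<otimes> y)) \<in> (steps D (carrier G))\<^sup>*"
      by (intro shift one) (use assms(3) in auto)
    then show "(x, y) \<in> (steps D (carrier G))\<^sup>*"
      using xy by (simp add: free_reduce)
  qed
qed

text \<open>
  The difference \<open>dist x u - dist u y\<close> measures the position of the projection of \<open>u\<close> to the
  geodesic from \<open>x\<close> to \<open>y\<close>.  If \<open>u\<close> and \<open>v\<close> have different projections, then the geodesic between
  them runs through both projections, so neither point is further from the geodesic than \<open>dist u v\<close>.
\<close>

lemma between_if_crossing:
  assumes x: "x \<in> carrier G" and y: "y \<in> carrier G" and u: "u \<in> carrier G" and v: "v \<in> carrier G"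
    and cross: "dist x u - dist u y < dist x v - dist v y" and D: "dist u v \<le> D"
  shows "between (2 * D) x v y"
  using four_point_cases[OF x y v u] dist_commute[OF y u] dist_commute[OF u v]
    dist_commute[OF y v] dist_triangle[OF v u y] cross D
  unfolding between_def by linarith

lemma dist_le_between:
  assumes x: "x \<in> carrier G" and y: "y \<in> carrier G" and u: "u \<in> carrier G" and v: "v \<in> carrier G"
    and b: "between C x u y" "between C x v y"
  shows "2 * dist u v \<le> 2 * C + \<bar>(dist x u - dist u y) - (dist x v - dist v y)\<bar>"
  using four_point_cases[OF x u y v] b dist_commute[OF u y] dist_commute[OF v y]
  unfolding between_def by linarith

text \<open>
  A word path from \<open>x\<close> to \<open>y\<close> may stray far from the geodesic, but its projection passes every
  position, and where it crosses a position the path is near the geodesic.  The crossing points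
  of consecutive positions are close to each other, and so form a path that stays near the geodesic.
\<close>

lemma steps_connected_between:
  assumes "finite S" "S \<subseteq> carrier G" "generate G S = carrier G"
  obtains D C where "D \<ge> 0" "C \<ge> 0"
    "\<And>x y. x \<in> carrier G \<Longrightarrow> y \<in> carrier G \<Longrightarrow>
      (x, y) \<in> (steps D {u \<in> carrier G. between C x u y})\<^sup>*"
proof -
  obtain D where D: "D \<ge> 0"
    "\<And>x y. x \<in> carrier G \<Longrightarrow> y \<in> carrier G \<Longrightarrow> (x, y) \<in> (steps D (carrier G))\<^sup>*"
    using steps_connected[OF assms] by blast
  have "(x, y) \<in> (steps (6 * D + 1) {u \<in> carrier G. between (2 * D) x u y})\<^sup>*"
    if xy: "x \<in> carrier G" "y \<in> carrier G" for x y
  proof -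
    let ?A = "{u \<in> carrier G. between (2 * D) x u y}"
    define f where "f u = dist x u + dist x y - dist u y" for u
    have fx: "f x = 0" using xy by (simp add: f_def dist_self)
    have fy: "f y = 2 * dist x y" using xy by (simp add: f_def dist_self)
    have fle: "f p \<le> f y" if "p \<in> carrier G" for p
      using dist_triangle[of x y p] dist_commute[of y p] xy that fy f_def by simp
    have f_lip: "f v \<le> f u + 2 * dist u v" if "u \<in> carrier G" "v \<in> carrier G" for u v
      using dist_triangle[of x u v] dist_triangle[of u v y] xy that by (simp add: f_def)
    have xA: "x \<in> ?A" and yA: "y \<in> ?A" using xy D(1) by (simp_all add: between_def dist_self)
    \<comment> \<open>\<open>f u\<close> is twice the distance from \<open>x\<close> to the projection of \<open>u\<close>; at every position \<open>t\<close> the word path has a crossing point.\<close>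
    have stop: "\<exists>p\<in>?A. t \<le> f p \<and> f p \<le> t + 2 * D" if t: "0 \<le> t" "t \<le> f y" for t
    proof (cases "t = 0")
      case True
      then show ?thesis using xA fx D(1) by force
    next
      case False
      obtain u v where uv: "(u, v) \<in> steps D (carrier G)" "f u < t" "\<not> f v < t"
        by (rule rtrancl_crossing[OF D(2)[OF xy], of "\<lambda>u. f u < t"]) (use t False fx in auto)
      then have c: "u \<in> carrier G" "v \<in> carrier G" "dist u v \<le> D" by (auto simp: steps_def)
      have "between (2 * D) x v y"
        by (rule between_if_crossing[of x y u v]) (use uv c xy in \<open>auto simp: f_def\<close>)
      then show ?thesis using c uv f_lip[OF c(1,2)] by (intro bexI[of _ v]) auto
    qed
    have step: "(p, q) \<in> steps (6 * D + 1) ?A"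
      if "p \<in> ?A" "q \<in> ?A" "\<bar>f p - f q\<bar> \<le> 2 * D + 1" for p q
      using dist_le_between[of x y p q "2 * D"] that xy D(1) by (auto simp: steps_def f_def)
    \<comment> \<open>Induction along the geodesic: a point \<open>p\<close> with \<open>f p = k + 1 + 2 * D\<close> is one step away from a crossing point of position \<open>k\<close>.\<close>
    have reach: "(x, p) \<in> (steps (6 * D + 1) ?A)\<^sup>*" if "p \<in> ?A" "f p \<le> int k + 2 * D" for k p
      using that
    proof (induction k arbitrary: p)
      case 0
      have "f p \<ge> 0" using 0 xy dist_triangle[of p x y] dist_commute[of p x] by (simp add: f_def)
      then have "(x, p) \<in> steps (6 * D + 1) ?A" using step[OF xA 0(1)] 0(2) fx by simp
      then show ?case by blast
    next
      case (Suc k)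
      show ?case
      proof (cases "f p \<le> int k + 2 * D")
        case True
        then show ?thesis using Suc.IH Suc.prems by blast
      next
        case False
        then have "int k \<le> f y" using fle[of p] Suc.prems(1) D(1) by auto
        then obtain q where q: "q \<in> ?A" "int k \<le> f q" "f q \<le> int k + 2 * D"
          using stop[of "int k"] by auto
        then have "(q, p) \<in> steps (6 * D + 1) ?A" using step[OF q(1) Suc.prems(1)] Suc.prems False by simp
        then show ?thesis using Suc.IH[OF q(1,3)] by simp
      qed
    qed
    have "f y \<le> int (nat (f y)) + 2 * D" using D(1) by linarith
    then show ?thesis using reach yA by blast
  qed
  then show ?thesis using that[of "6 * D + 1" "2 * D"] D(1) by simp
qed

definition coarse_embedding :: "('g \<Rightarrow> 'g) \<Rightarrow> bool" where
  "coarse_embedding \<psi> \<longleftrightarrow> \<psi> \<in> carrier G \<rightarrow> carrier G \<and>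
     (\<forall>r. \<exists>B. \<forall>x\<in>carrier G. \<forall>y\<in>carrier G. dist x y \<le> r \<longrightarrow> dist (\<psi> x) (\<psi> y) \<le> B) \<and>
     (\<forall>r. \<exists>B. \<forall>x\<in>carrier G. \<forall>y\<in>carrier G. dist (\<psi> x) (\<psi> y) \<le> r \<longrightarrow> dist x y \<le> B)"

lemma coarse_embedding_bounded:
  assumes "coarse_embedding \<psi>"
  obtains B where "B \<ge> 0"
    "\<And>x y. x \<in> carrier G \<Longrightarrow> y \<in> carrier G \<Longrightarrow> dist x y \<le> r \<Longrightarrow> dist (\<psi> x) (\<psi> y) \<le> B"
proof -
  obtain B where B: "\<forall>x\<in>carrier G. \<forall>y\<in>carrier G. dist x y \<le> r \<longrightarrow> dist (\<psi> x) (\<psi> y) \<le> B"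
    using assms unfolding coarse_embedding_def by blast
  show ?thesis
    by (rule that[of "max B 0"]) (use B in \<open>simp_all add: le_max_iff_disj\<close>)
qed

lemma coarse_embedding_proper:
  assumes "coarse_embedding \<psi>"
  obtains B where "B \<ge> 0"
    "\<And>x y. x \<in> carrier G \<Longrightarrow> y \<in> carrier G \<Longrightarrow> dist (\<psi> x) (\<psi> y) \<le> r \<Longrightarrow> dist x y \<le> B"
proof -
  obtain B where B: "\<forall>x\<in>carrier G. \<forall>y\<in>carrier G. dist (\<psi> x) (\<psi> y) \<le> r \<longrightarrow> dist x y \<le> B"
    using assms unfolding coarse_embedding_def by blast
  show ?thesis
    by (rule that[of "max B 0"]) (use B in \<open>simp_all add: le_max_iff_disj\<close>)
qed

text \<open>
  The image of a path near the geodesic from \<open>x\<close> to \<open>y\<close> is a path with bounded steps from \<open>\<psi> x\<close>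
  to \<open>\<psi> y\<close>.  Where its projection to the geodesic from \<open>\<psi> x\<close> to \<open>b\<close> first reaches that of \<open>\<psi> y\<close>,
  it is near the median of the tripod with ends \<open>\<psi> x\<close>, \<open>\<psi> y\<close> and \<open>b\<close>.
\<close>

lemma image_passes_centre:
  assumes gens: "finite S" "S \<subseteq> carrier G" "generate G S = carrier G"
    and \<psi>: "coarse_embedding \<psi>"
  obtains C where "C \<ge> 0"
    "\<And>x y b. x \<in> carrier G \<Longrightarrow> y \<in> carrier G \<Longrightarrow> b \<in> carrier G \<Longrightarrow>
      \<exists>u\<in>carrier G. between C x u y \<and> between C (\<psi> x) (\<psi> u) (\<psi> y) \<and>
        between C (\<psi> x) (\<psi> u) b \<and> between C (\<psi> y) (\<psi> u) b"
proof -
  obtain D C where D: "D \<ge> 0" "C \<ge> 0"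
    "\<And>x y. x \<in> carrier G \<Longrightarrow> y \<in> carrier G \<Longrightarrow>
      (x, y) \<in> (steps D {u \<in> carrier G. between C x u y})\<^sup>*"
    using steps_connected_between[OF gens] by blast
  obtain B where B: "B \<ge> 0"
    "\<And>x y. x \<in> carrier G \<Longrightarrow> y \<in> carrier G \<Longrightarrow> dist x y \<le> D \<Longrightarrow> dist (\<psi> x) (\<psi> y) \<le> B"
    using coarse_embedding_bounded[OF \<psi>] by blast
  have \<psi>G: "\<psi> x \<in> carrier G" if "x \<in> carrier G" for x
    using \<psi> that by (auto simp: coarse_embedding_def)
  define C' where "C' = C + 4 * B"
  have "\<exists>u\<in>carrier G. between C' x u y \<and> between C' (\<psi> x) (\<psi> u) (\<psi> y) \<and>
        between C' (\<psi> x) (\<psi> u) b \<and> between C' (\<psi> y) (\<psi> u) b"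
    if xyb: "x \<in> carrier G" "y \<in> carrier G" "b \<in> carrier G" for x y b
  proof -
    define f where "f p = dist (\<psi> x) p + dist (\<psi> x) b - dist p b" for p
    have fx: "f (\<psi> x) = 0" using xyb \<psi>G by (simp add: f_def dist_self)
    show ?thesis
    proof (cases "f (\<psi> y) \<le> 0")
      case True
      show ?thesis
        using True xyb \<psi>G D(2) B(1) dist_commute[of "\<psi> x" "\<psi> y"]
        by (intro bexI[of _ x]) (auto simp: between_def f_def C'_def dist_self)
    next
      case False
      obtain u v where uv: "(u, v) \<in> steps D {u \<in> carrier G. between C x u y}"
        "f (\<psi> u) < f (\<psi> y)" "\<not> f (\<psi> v) < f (\<psi> y)"
        by (rule rtrancl_crossing[OF D(3)[OF xyb(1,2)], of "\<lambda>u. f (\<psi> u) < f (\<psi> y)"])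
          (use False fx in auto)
      then have c: "u \<in> carrier G" "v \<in> carrier G" "dist u v \<le> D" "between C x v y"
        by (auto simp: steps_def)
      let ?X = "\<psi> x" and ?Y = "\<psi> y" and ?U = "\<psi> u" and ?V = "\<psi> v"
      have G: "?X \<in> carrier G" "?Y \<in> carrier G" "?U \<in> carrier G" "?V \<in> carrier G"
        using c xyb \<psi>G by auto
      have UV: "dist ?U ?V \<le> B" using B(2) c by blast
      have XVb: "between (2 * B) ?X ?V b"
        by (rule between_if_crossing[of _ _ ?U]) (use uv G xyb UV in \<open>auto simp: f_def\<close>)
      have fV: "f ?V \<le> f ?U + 2 * B"
        using dist_triangle[of ?X ?U ?V] dist_triangle[of ?U ?V b] UV xyb G by (simp add: f_def)
      have lower: "dist ?X ?Y - dist ?Y b \<le> dist ?X ?V - dist ?V b"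
        and upper: "dist ?X ?V - dist ?V b \<le> dist ?X ?Y - dist ?Y b + 2 * B"
        using uv(2,3) fV by (simp_all add: f_def)
      have fp: "dist ?X b + dist ?V ?Y \<le> dist ?X ?V + dist ?Y b \<or>
          dist ?X b + dist ?V ?Y \<le> dist ?X ?Y + dist ?V b"
        using four_point_cases[of ?X ?V b ?Y] G xyb dist_commute[of b ?Y] by auto
      have sides: "between (4 * B) ?X ?V ?Y" "between (4 * B) ?Y ?V b"
        using fp lower upper XVb B(1) dist_commute[OF G(4,2)] unfolding between_def by linarith+
      show ?thesis
        using c sides XVb D(2) B(1) by (intro bexI[of _ v]) (auto simp: between_def C'_def)
    qed
  qed
  then show ?thesis using that[of C'] D(2) B(1) by (simp add: C'_def)
qed

text \<open>
  A tripod has only one median.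
\<close>

lemma centres_close:
  assumes p: "p \<in> carrier G" and q: "q \<in> carrier G" and r: "r \<in> carrier G"
    and u: "u \<in> carrier G" and v: "v \<in> carrier G"
    and "between C p u q" "between C p u r" "between C q u r"
    and "between C p v q" "between C p v r" "between C q v r"
  shows "dist u v \<le> 2 * C"
  using four_point_cases[OF p u r v] assms(6-) dist_commute[OF u q] dist_commute[OF v q]
    dist_commute[OF u r] dist_commute[OF v r]
    dist_triangle[OF q u r] dist_triangle[OF q v r] dist_triangle[OF p u q] dist_triangle[OF p v q]
  unfolding between_def by linarith

text \<open>
  Take \<open>u\<close> between \<open>x\<close> and \<open>g\<close>, and \<open>v\<close> between \<open>y\<close> and \<open>g\<close>, whose images are near the median of
  \<open>\<psi> x\<close>, \<open>\<psi> g\<close>, \<open>\<psi> y\<close>.  The images are close to each other, hence so are \<open>u\<close> and \<open>v\<close>.  But \<open>g\<close>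
  lies between \<open>u\<close> and \<open>v\<close>, so \<open>\<psi> g\<close> is close to \<open>\<psi> u\<close>, which is near the geodesic from \<open>\<psi> x\<close> to
  \<open>\<psi> y\<close>.
\<close>

lemma bounded_cancellation:
  assumes gens: "finite S" "S \<subseteq> carrier G" "generate G S = carrier G"
    and \<psi>: "coarse_embedding \<psi>"
  obtains E' where "E' \<ge> 0"
    "\<And>x g y. x \<in> carrier G \<Longrightarrow> g \<in> carrier G \<Longrightarrow> y \<in> carrier G \<Longrightarrow>
      between E x g y \<Longrightarrow> between E' (\<psi> x) (\<psi> g) (\<psi> y)"
proof -
  obtain C where C: "C \<ge> 0"
    "\<And>x y b. x \<in> carrier G \<Longrightarrow> y \<in> carrier G \<Longrightarrow> b \<in> carrier G \<Longrightarrow>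
      \<exists>u\<in>carrier G. between C x u y \<and> between C (\<psi> x) (\<psi> u) (\<psi> y) \<and>
        between C (\<psi> x) (\<psi> u) b \<and> between C (\<psi> y) (\<psi> u) b"
    using image_passes_centre[OF gens \<psi>] by blast
  obtain B1 where B1: "B1 \<ge> 0"
    "\<And>x y. x \<in> carrier G \<Longrightarrow> y \<in> carrier G \<Longrightarrow> dist (\<psi> x) (\<psi> y) \<le> 2 * C \<Longrightarrow> dist x y \<le> B1"
    using coarse_embedding_proper[OF \<psi>] by blast
  obtain B2 where B2: "B2 \<ge> 0"
    "\<And>x y. x \<in> carrier G \<Longrightarrow> y \<in> carrier G \<Longrightarrow> dist x y \<le> B1 + 2 * C + E \<Longrightarrow>
      dist (\<psi> x) (\<psi> y) \<le> B2"
    using coarse_embedding_bounded[OF \<psi>] by blast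
  have \<psi>G: "\<psi> x \<in> carrier G" if "x \<in> carrier G" for x
    using \<psi> that by (auto simp: coarse_embedding_def)
  have "between (C + 2 * B2) (\<psi> x) (\<psi> g) (\<psi> y)"
    if G: "x \<in> carrier G" "g \<in> carrier G" "y \<in> carrier G" and xgy: "between E x g y" for x g y
  proof -
    obtain u where u: "u \<in> carrier G" "between C x u g" "between C (\<psi> x) (\<psi> u) (\<psi> g)"
      "between C (\<psi> x) (\<psi> u) (\<psi> y)" "between C (\<psi> g) (\<psi> u) (\<psi> y)"
      using C(2)[of x g "\<psi> y"] G \<psi>G by blast
    obtain v where v: "v \<in> carrier G" "between C y v g" "between C (\<psi> y) (\<psi> v) (\<psi> g)"
      "between C (\<psi> y) (\<psi> v) (\<psi> x)" "between C (\<psi> g) (\<psi> v) (\<psi> x)"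
      using C(2)[of y g "\<psi> x"] G \<psi>G by blast
    have sym: "between C p w q \<longleftrightarrow> between C q w p"
      if "p \<in> carrier G" "q \<in> carrier G" "w \<in> carrier G" for p q w
      using that by (auto simp: between_def dist_commute)
    have "dist (\<psi> u) (\<psi> v) \<le> 2 * C"
      by (rule centres_close[of "\<psi> x" "\<psi> g" "\<psi> y"]) (use u v G \<psi>G sym in auto)
    then have "dist u v \<le> B1" using B1(2) u v by blast
    then have "dist u g \<le> B1 + 2 * C + E"
      using u(2) v(2) xgy dist_triangle[OF G(1) u(1) G(3)] dist_triangle[OF u(1) v(1) G(3)]
        dist_commute[OF G(3) v(1)] dist_commute[OF G(3,2)] dist_nonneg[OF v(1) G(2)]
      unfolding between_def by linarith
    then have "dist (\<psi> u) (\<psi> g) \<le> B2" using B2(2) u(1) G by blast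
    then show ?thesis
      using u(4) dist_triangle[OF \<psi>G[OF G(1)] \<psi>G[OF u(1)] \<psi>G[OF G(2)]]
        dist_triangle[OF \<psi>G[OF G(2)] \<psi>G[OF u(1)] \<psi>G[OF G(3)]]
        dist_commute[OF \<psi>G[OF u(1)] \<psi>G[OF G(2)]]
      unfolding between_def by linarith
  qed
  then show ?thesis using that[of "C + 2 * B2"] C(1) B2(1) by simp
qed

lemma bounded_cancellation_iterates:
  assumes gens: "finite S" "S \<subseteq> carrier G" "generate G S = carrier G"
    and \<psi>: "coarse_embedding \<psi>"
  shows "\<exists>E'. \<forall>i\<le>n. \<forall>x\<in>carrier G. \<forall>g\<in>carrier G. \<forall>y\<in>carrier G.
      between E x g y \<longrightarrow> between E' ((\<psi> ^^ i) x) ((\<psi> ^^ i) g) ((\<psi> ^^ i) y)"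
proof (induction n)
  case 0
  then show ?case by auto
next
  case (Suc n)
  then obtain E1 where E1: "\<And>i x g y. i \<le> n \<Longrightarrow> x \<in> carrier G \<Longrightarrow> g \<in> carrier G \<Longrightarrow>
      y \<in> carrier G \<Longrightarrow> between E x g y \<Longrightarrow> between E1 ((\<psi> ^^ i) x) ((\<psi> ^^ i) g) ((\<psi> ^^ i) y)"
    by blast
  obtain E2 where E2: "E2 \<ge> 0" "\<And>x g y. x \<in> carrier G \<Longrightarrow> g \<in> carrier G \<Longrightarrow> y \<in> carrier G \<Longrightarrow>
      between E1 x g y \<Longrightarrow> between E2 (\<psi> x) (\<psi> g) (\<psi> y)"
    using bounded_cancellation[OF gens \<psi>] by blast
  have iter: "(\<psi> ^^ i) x \<in> carrier G" if "x \<in> carrier G" for i x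
    using that \<psi> by (induction i) (auto simp: coarse_embedding_def)
  have "between (max E1 E2) ((\<psi> ^^ i) x) ((\<psi> ^^ i) g) ((\<psi> ^^ i) y)"
    if "i \<le> Suc n" "x \<in> carrier G" "g \<in> carrier G" "y \<in> carrier G" "between E x g y" for i x g y
  proof (cases "i \<le> n")
    case True
    then show ?thesis using E1[of i x g y] that by (simp add: between_def)
  next
    case False
    then have "i = Suc n" using that by simp
    moreover have "between E2 (\<psi> ((\<psi> ^^ n) x)) (\<psi> ((\<psi> ^^ n) g)) (\<psi> ((\<psi> ^^ n) y))"
      using E2(2) E1[of n x g y] that iter by blast
    ultimately show ?thesis by (simp add: between_def)
  qed
  then show ?case by blast
qed

text \<open>
  This is the coarse version of the fact that an increasing self-map of an interval of finite
  order is the identity.  Both \<open>g\<close> and \<open>\<psi> g\<close> are near the geodesic from \<open>x\<close> to \<open>y\<close>, so one of them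
  lies coarsely between \<open>x\<close> and the other; bounded cancellation transports this to all pairs of
  consecutive iterates.  Adding up the resulting inequalities over one period, the distances from
  \<open>x\<close> telescope to \<open>0\<close>, and what remains bounds the sum of the distances between the iterates.
\<close>

lemma periodic_displacement_bounded:
  assumes gens: "finite S" "S \<subseteq> carrier G" "generate G S = carrier G"
    and \<psi>: "coarse_embedding \<psi>" and n: "n > 0"
    and per: "\<And>g. g \<in> carrier G \<Longrightarrow> (\<psi> ^^ n) g = g"
  obtains R where
    "\<And>x g y. x \<in> carrier G \<Longrightarrow> g \<in> carrier G \<Longrightarrow> y \<in> carrier G \<Longrightarrow> \<psi> x = x \<Longrightarrow> \<psi> y = y \<Longrightarrow>
      between E x g y \<Longrightarrow> dist g (\<psi> g) \<le> R"
proof -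
  obtain E0 where E0: "E0 \<ge> 0" "\<And>x g y. x \<in> carrier G \<Longrightarrow> g \<in> carrier G \<Longrightarrow> y \<in> carrier G \<Longrightarrow>
      between E x g y \<Longrightarrow> between E0 (\<psi> x) (\<psi> g) (\<psi> y)"
    using bounded_cancellation[OF gens \<psi>] by blast
  define E1 where "E1 = max E E0"
  obtain E2 where E2: "\<And>i x g y. i \<le> n \<Longrightarrow> x \<in> carrier G \<Longrightarrow> g \<in> carrier G \<Longrightarrow>
      y \<in> carrier G \<Longrightarrow> between E1 x g y \<Longrightarrow> between E2 ((\<psi> ^^ i) x) ((\<psi> ^^ i) g) ((\<psi> ^^ i) y)"
    using bounded_cancellation_iterates[OF gens \<psi>, of n E1] by blast
  have iter: "(\<psi> ^^ i) x \<in> carrier G" if "x \<in> carrier G" for i x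
    using that \<psi> by (induction i) (auto simp: coarse_embedding_def)
  have "dist g (\<psi> g) \<le> int n * E2"
    if G: "x \<in> carrier G" "g \<in> carrier G" "y \<in> carrier G" and fix_xy: "\<psi> x = x" "\<psi> y = y"
      and xgy: "between E x g y" for x g y
  proof -
    define p where "p i = (\<psi> ^^ i) g" for i
    have pG: "p i \<in> carrier G" for i using iter G by (simp add: p_def)
    have x_iter: "(\<psi> ^^ i) x = x" for i using fix_xy(1) by (induction i) auto
    have \<psi>g: "\<psi> g \<in> carrier G" using iter[of g 1] G by simp
    have b1: "between E1 x g y" using xgy by (simp add: between_def E1_def)
    have b2: "between E1 x (\<psi> g) y"
      using E0(2)[OF G xgy] fix_xy by (simp add: between_def E1_def)
    have "between E1 x g (\<psi> g) \<or> between E1 x (\<psi> g) g"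
      using four_point_cases[OF G \<psi>g] b1 b2 dist_commute[OF G(2) \<psi>g]
        dist_commute[OF G(2,3)] dist_commute[OF \<psi>g G(3)]
      unfolding between_def by linarith
    moreover have period: "p n = p 0" using per[OF G(2)] by (simp add: p_def)
    moreover have tele: "(\<Sum>i<n. dist x (p (Suc i)) - dist x (p i)) = 0"
      using sum_lessThan_telescope[of "\<lambda>i. dist x (p i)" n] period by simp
    have first: "dist (p 0) (p 1) \<le> (\<Sum>i<n. dist (p i) (p (Suc i)))"
      using n pG dist_nonneg
      by (intro order_trans[OF _ member_le_sum[of 0]]) auto
    ultimately consider (fwd) "between E1 x g (\<psi> g)" | (bwd) "between E1 x (\<psi> g) g" by blast
    then have "(\<Sum>i<n. dist (p i) (p (Suc i))) \<le> (\<Sum>i<n. E2)"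
    proof cases
      case fwd
      have "dist (p i) (p (Suc i)) \<le> (dist x (p (Suc i)) - dist x (p i)) + E2" if "i < n" for i
        using E2[of i x g "\<psi> g"] that fwd G \<psi>g x_iter
        by (simp add: between_def p_def funpow_swap1)
      then have "(\<Sum>i<n. dist (p i) (p (Suc i)))
          \<le> (\<Sum>i<n. (dist x (p (Suc i)) - dist x (p i)) + E2)"
        by (intro sum_mono) auto
      then show ?thesis using tele by (simp add: sum.distrib)
    next
      case bwd
      have "dist (p i) (p (Suc i)) \<le> - (dist x (p (Suc i)) - dist x (p i)) + E2" if "i < n" for i
        using E2[of i x "\<psi> g" g] that bwd G \<psi>g x_iter dist_commute[OF pG pG, of i "Suc i"]
        by (simp add: between_def p_def funpow_swap1)
      then have "(\<Sum>i<n. dist (p i) (p (Suc i)))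
          \<le> (\<Sum>i<n. - (dist x (p (Suc i)) - dist x (p i)) + E2)"
        by (intro sum_mono) auto
      also have "\<dots> = - (\<Sum>i<n. dist x (p (Suc i)) - dist x (p i)) + (\<Sum>i<n. E2)"
        by (simp only: sum.distrib sum_negf)
      finally show ?thesis using tele by simp
    qed
    then show ?thesis using first by (simp add: p_def)
  qed
  then show ?thesis using that by blast
qed

end

section \<open>Periodic automorphisms and the vertex stabiliser\<close>

text \<open>
  The length function of a group acting on a locally finite tree, with an infinite cyclic
  stabiliser \<open>K = \<langle>a\<rangle>\<close> of the base point.  The assumption \<open>balls\<close> stands for local finiteness.
\<close>

locale cyclic_length = lyndon_length G len for G :: "('g, 'b) monoid_scheme" (structure) and len +
  fixes a :: 'g
  assumes a_carrier [simp]: "a \<in> carrier G"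
    and len_zero: "g \<in> carrier G \<Longrightarrow> len g = 0 \<longleftrightarrow> g \<in> range (\<lambda>i::int. a [^] i)"
    and infinite_order: "a [^] (i::int) = \<one> \<Longrightarrow> i = 0"
    and balls: "\<exists>S. finite S \<and> S \<subseteq> carrier G \<and>
      (\<forall>g\<in>carrier G. len g \<le> r \<longrightarrow> (\<exists>s\<in>S. len (inv s \<otimes> g) = 0))"
    and finitely_generated: "\<exists>S. finite S \<and> S \<subseteq> carrier G \<and> generate G S = carrier G"
begin

definition K :: "'g set" where
  "K = {g \<in> carrier G. len g = 0}"

lemma K_eq: "K = range (\<lambda>i::int. a [^] i)"
  using len_zero by (auto simp: K_def)

lemma len_pow_a [simp]: "len (a [^] (i::int)) = 0"
  using K_eq by (auto simp: K_def)

lemma pow_a_eq: "a [^] (i::int) = a [^] (j::int) \<Longrightarrow> i = j"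
  using infinite_order[of "i - j"] by (simp add: int_pow_diff)

lemma len_mult_K: "g \<in> carrier G \<Longrightarrow> k \<in> K \<Longrightarrow> len (g \<otimes> k) \<le> len g"
  using len_mult[of g k] by (simp add: K_def)

lemma K_subgroup: "subgroup K G"
proof
  show "x \<otimes> y \<in> K" if "x \<in> K" "y \<in> K" for x y
    using that len_mult_K[of x y] len_nonneg[of "x \<otimes> y"] by (auto simp: K_def)
qed (auto simp: K_def len_one len_inv)

text \<open>
  A sequence in a ball hits one of its finitely many cosets of \<open>K\<close> twice.
\<close>

lemma pigeonhole_ball:
  assumes "\<And>i::nat. x i \<in> carrier G" "\<And>i. len (x i) \<le> r"
  obtains i j where "i < j" "inv (x i) \<otimes> x j \<in> K"
proof -
  obtain S where S: "finite S" "S \<subseteq> carrier G"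
    "\<And>g. g \<in> carrier G \<Longrightarrow> len g \<le> r \<Longrightarrow> \<exists>s\<in>S. len (inv s \<otimes> g) = 0"
    using balls[of r] by blast
  have "\<exists>s\<in>S. inv s \<otimes> x i \<in> K" for i
  proof -
    obtain s where "s \<in> S" "len (inv s \<otimes> x i) = 0" using S(3)[OF assms] by blast
    moreover have "inv s \<otimes> x i \<in> carrier G" using \<open>s \<in> S\<close> S(2) assms(1) by blast
    ultimately show ?thesis unfolding K_def by blast
  qed
  then have "\<forall>i\<in>UNIV. \<exists>s\<in>S. inv s \<otimes> x i \<in> K" by blast
  then obtain s where s: "s \<in> S" "infinite {i::nat. inv s \<otimes> x i \<in> K}"
    using pigeonhole_infinite_rel[OF infinite_UNIV_nat S(1), of "\<lambda>i s. inv s \<otimes> x i \<in> K"] by auto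
  then obtain i where i: "inv s \<otimes> x i \<in> K" by (metis (no_types, lifting) finite.emptyI mem_Collect_eq subsetI subset_empty)
  obtain j where j: "i < j" "inv s \<otimes> x j \<in> K"
    using s(2) unfolding infinite_nat_iff_unbounded by blast
  have "inv (inv s \<otimes> x i) \<otimes> (inv s \<otimes> x j) \<in> K"
    using i j subgroup.m_closed[OF K_subgroup] subgroup.m_inv_closed[OF K_subgroup] by blast
  moreover have "inv (inv s \<otimes> x i) \<otimes> (inv s \<otimes> x j) = inv (x i) \<otimes> x j"
    using s(1) S(2) assms(1) by (simp add: free_reduce subset_iff)
  ultimately show ?thesis using that j(1) by simp
qed

text \<open>
  All elements \<open>a^i \<otimes> inv s\<close> lie in one ball, so two of them differ by an element of \<open>K\<close>.
\<close>

lemma commensurated: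
  assumes "s \<in> carrier G"
  obtains N L :: int where "N > 0" "L \<noteq> 0" "s \<otimes> a [^] N \<otimes> inv s = a [^] L"
proof -
  define x where "x i = a [^] int i \<otimes> inv s" for i
  obtain i j where ij: "i < j" "inv (x i) \<otimes> x j \<in> K"
  proof (rule pigeonhole_ball[of x "len s"])
    show "x i \<in> carrier G" for i using assms by (simp add: x_def)
    show "len (x i) \<le> len s" for i
      using assms len_mult[of "a [^] int i" "inv s"] by (simp add: x_def len_inv)
  qed
  let ?N = "int j - int i"
  have "a [^] ?N = inv (a [^] int i) \<otimes> a [^] int j"
    using int_pow_mult[of a "- int i" "int j"] by (simp add: int_pow_neg)
  then have "inv (x i) \<otimes> x j = s \<otimes> a [^] ?N \<otimes> inv s"
    using assms by (simp add: x_def free_reduce)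
  then obtain L :: int where L: "s \<otimes> a [^] ?N \<otimes> inv s = a [^] L"
    using ij(2) K_eq by auto
  have "L \<noteq> 0"
  proof
    assume "L = 0"
    then have "s \<otimes> a [^] ?N = s" using L assms by (metis int_pow_0 inv_solve_right' int_pow_closed a_carrier l_one m_closed one_closed)
    then have "a [^] ?N = \<one>" using assms by (simp add: r_cancel_one')
    then show False using infinite_order[of ?N] ij(1) by simp
  qed
  then show ?thesis using that[of ?N L] L ij(1) by simp
qed

end

locale periodic_endomorphism = cyclic_length G len a
  for G :: "('g, 'b) monoid_scheme" (structure) and len a +
  fixes \<phi> :: "'g \<Rightarrow> 'g" and n :: nat
  assumes \<phi>_hom: "\<phi> \<in> hom G G" and period_pos: "n > 0"
    and periodic: "g \<in> carrier G \<Longrightarrow> (\<phi> ^^ n) g = g"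

sublocale periodic_endomorphism \<subseteq> \<phi>: group_hom G G \<phi>
  by unfold_locales (rule \<phi>_hom)

context group
begin

lemma hom_funpow:
  assumes "\<theta> \<in> hom G G"
  shows "\<theta> ^^ j \<in> hom G G"
  using assms by (induction j) (auto simp: hom_def Pi_iff)

lemma funpow_closed:
  assumes "\<theta> \<in> hom G G" "x \<in> carrier G"
  shows "(\<theta> ^^ j) x \<in> carrier G"
  using hom_funpow[OF assms(1), of j] assms(2) by (auto simp: hom_def)

lemma conj_int_pow:
  assumes "s \<in> carrier G" "x \<in> carrier G"
  shows "(s \<otimes> x \<otimes> inv s) [^] (l::int) = s \<otimes> x [^] l \<otimes> inv s"
proof -
  have "(\<lambda>x. s \<otimes> x \<otimes> inv s) \<in> hom G G" using assms(1) by (auto simp: hom_def free_reduce)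
  then interpret c: group_hom G G "\<lambda>x. s \<otimes> x \<otimes> inv s" by unfold_locales
  show ?thesis using c.hom_int_pow[OF assms(2), of l] by simp
qed

lemma hom_power_iterate:
  fixes P Q :: int
  assumes \<theta>: "\<theta> \<in> hom G G" and x: "x \<in> carrier G" and eq: "\<theta> (x [^] P) = x [^] Q"
  shows "(\<theta> ^^ j) (x [^] (P ^ j)) = x [^] (Q ^ j)"
proof (induction j)
  case 0
  then show ?case using x by simp
next
  case (Suc j)
  interpret \<theta>: group_hom G G \<theta> by unfold_locales (rule \<theta>)
  interpret \<theta>j: group_hom G G "\<theta> ^^ j" by unfold_locales (rule hom_funpow[OF \<theta>])
  have "(\<theta> ^^ j) (x [^] (P ^ Suc j)) = (\<theta> ^^ j) ((x [^] (P ^ j)) [^] P)"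
    using x by (simp add: int_pow_pow mult.commute)
  also have "\<dots> = (x [^] (Q ^ j)) [^] P"
    using x Suc \<theta>j.hom_int_pow[of "x [^] (P ^ j)" P] by simp
  also have "\<dots> = (x [^] P) [^] (Q ^ j)"
    using x by (simp add: int_pow_pow mult.commute)
  finally have "(\<theta> ^^ Suc j) (x [^] (P ^ Suc j)) = \<theta> ((x [^] P) [^] (Q ^ j))"
    by simp
  also have "\<dots> = (x [^] Q) [^] (Q ^ j)"
    using x eq \<theta>.hom_int_pow[of "x [^] P" "Q ^ j"] by simp
  finally show ?case using x by (simp add: int_pow_pow)
qed

end

context cyclic_length
begin

text \<open>
  Iterating \<open>\<theta> (a^P) = a^Q\<close> gives that \<open>\<theta> ^^ n\<close> maps \<open>a^(P^n)\<close> to \<open>a^(Q^n)\<close>; but it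
  is the identity on \<open>K\<close>.
\<close>

lemma periodic_exponent:
  fixes P Q :: int
  assumes \<theta>: "\<theta> \<in> hom G G" and n: "n > 0" and per: "\<And>i::int. (\<theta> ^^ n) (a [^] i) = a [^] i"
    and eq: "\<theta> (a [^] P) = a [^] Q"
  shows "\<bar>P\<bar> = \<bar>Q\<bar>"
proof -
  have "a [^] (P ^ n) = a [^] (Q ^ n)"
    using hom_power_iterate[OF \<theta> a_carrier eq, of n] per by simp
  then have "P ^ n = Q ^ n" by (rule pow_a_eq)
  then have "\<bar>P\<bar> ^ n = \<bar>Q\<bar> ^ n" by (metis power_abs)
  then show ?thesis by (rule power_eq_imp_eq_base[OF _ _ _ n]) auto
qed

end

context periodic_endomorphism
begin

lemma Fix_subgroup: "subgroup (Fix G \<phi>) G"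
  by unfold_locales (auto simp: Fix_def)

text \<open>
  The fibres of the cocycle \<open>g \<mapsto> inv g \<otimes> \<phi> g\<close> are cosets of the fixed subgroup, so counting
  cosets of \<open>Fix G \<phi>\<close> amounts to counting values of the cocycle.
\<close>

lemma same_cocycle_value:
  assumes "g \<in> carrier G" "g' \<in> carrier G" "inv g \<otimes> \<phi> g = inv g' \<otimes> \<phi> g'"
  shows "g' \<otimes> inv g \<in> Fix G \<phi>"
proof -
  have "\<phi> g' = g' \<otimes> (inv g \<otimes> \<phi> g)"
    using assms by (simp add: free_reduce)
  then show ?thesis
    using assms(1,2) by (simp add: Fix_def free_reduce)
qed

text \<open>
  A ball consists of finitely many cosets \<open>s K\<close>, and \<open>\<phi> (s \<otimes> a^i)\<close> is
  \<open>\<phi> s \<otimes> (\<phi> a)^(i mod p)\<close> up to right multiplication by \<open>K\<close>.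
\<close>

lemma bounded_on_balls:
  assumes p: "p > 0" and comm: "\<phi> a [^] (p::int) \<in> K"
  obtains B where "\<And>g. g \<in> carrier G \<Longrightarrow> len g \<le> r \<Longrightarrow> len (\<phi> g) \<le> B"
proof -
  obtain S where S: "finite S" "S \<subseteq> carrier G"
    "\<And>g. g \<in> carrier G \<Longrightarrow> len g \<le> r \<Longrightarrow> \<exists>s\<in>S. len (inv s \<otimes> g) = 0"
    using balls[of r] by blast
  define B where "B = Max ((\<lambda>(s, i). len (\<phi> s \<otimes> \<phi> a [^] i)) ` (S \<times> {0..<p}))"
  have "len (\<phi> g) \<le> B" if g: "g \<in> carrier G" "len g \<le> r" for g
  proof -
    obtain s where s: "s \<in> S" "len (inv s \<otimes> g) = 0" using S(3) g by blast
    have sG: "s \<in> carrier G" using s S by blast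
    obtain i :: int where i: "inv s \<otimes> g = a [^] i"
      using s g sG len_zero[of "inv s \<otimes> g"] by auto
    have "g = s \<otimes> (inv s \<otimes> g)" using g sG by (simp add: free_reduce)
    then have "g = s \<otimes> a [^] i" using i by simp
    then have "\<phi> g = \<phi> s \<otimes> \<phi> a [^] i" using sG by (simp add: \<phi>.hom_int_pow)
    moreover have "\<phi> a [^] i = \<phi> a [^] (i mod p) \<otimes> (\<phi> a [^] p) [^] (i div p)"
      using int_pow_mult[of "\<phi> a" "i mod p" "p * (i div p)"] by (simp add: int_pow_pow)
    ultimately have "\<phi> g = (\<phi> s \<otimes> \<phi> a [^] (i mod p)) \<otimes> (\<phi> a [^] p) [^] (i div p)"
      using sG by (simp add: m_assoc)
    then have "len (\<phi> g) \<le> len (\<phi> s \<otimes> \<phi> a [^] (i mod p))"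
      using len_mult_K[OF _ subgroup_int_pow_closed[OF K_subgroup comm]] sG by simp
    moreover have "len (\<phi> s \<otimes> \<phi> a [^] (i mod p)) \<le> B"
      unfolding B_def using S(1) s(1) p by (intro Max_ge) auto
    ultimately show ?thesis by linarith
  qed
  then show ?thesis using that by blast
qed

text \<open>
  The inverse of \<open>\<phi>\<close> is an iterate of \<open>\<phi>\<close>, so it is bounded on balls as well.
\<close>

lemma \<phi>_coarse_embedding:
  assumes p: "p > 0" and comm: "\<phi> a [^] (p::int) \<in> K"
  shows "coarse_embedding \<phi>"
proof -
  have iterate: "\<exists>B. \<forall>g\<in>carrier G. len g \<le> r \<longrightarrow> len ((\<phi> ^^ j) g) \<le> B" for j r
  proof (induction j)
    case 0
    then show ?case by auto
  next
    case (Suc j)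
    then obtain B where B: "\<And>g. g \<in> carrier G \<Longrightarrow> len g \<le> r \<Longrightarrow> len ((\<phi> ^^ j) g) \<le> B" by blast
    obtain B' where "\<And>g. g \<in> carrier G \<Longrightarrow> len g \<le> B \<Longrightarrow> len (\<phi> g) \<le> B'"
      using bounded_on_balls[OF p comm] by blast
    then show ?case using B funpow_closed[OF \<phi>_hom] by (intro exI[of _ B']) simp
  qed
  have d: "dist (\<phi> x) (\<phi> y) = len (\<phi> (inv x \<otimes> y))" if "x \<in> carrier G" "y \<in> carrier G" for x y
    using that by (simp add: dist_def)
  have inverse: "(\<phi> ^^ (n - 1)) (\<phi> g) = g" if "g \<in> carrier G" for g
    using periodic[OF that] period_pos by (cases n) (auto simp: funpow_swap1)
  have "\<exists>B. \<forall>x\<in>carrier G. \<forall>y\<in>carrier G. dist x y \<le> r \<longrightarrow> dist (\<phi> x) (\<phi> y) \<le> B" for r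
  proof -
    obtain B where B: "\<forall>g\<in>carrier G. len g \<le> r \<longrightarrow> len ((\<phi> ^^ 1) g) \<le> B" using iterate by blast
    have "dist (\<phi> x) (\<phi> y) \<le> B" if "x \<in> carrier G" "y \<in> carrier G" "dist x y \<le> r" for x y
      unfolding d[OF that(1,2)] using B that by (simp add: dist_def del: \<phi>.hom_mult)
    then show ?thesis by blast
  qed
  moreover have "\<exists>B. \<forall>x\<in>carrier G. \<forall>y\<in>carrier G. dist (\<phi> x) (\<phi> y) \<le> r \<longrightarrow> dist x y \<le> B" for r
  proof -
    obtain B where B: "\<forall>g\<in>carrier G. len g \<le> r \<longrightarrow> len ((\<phi> ^^ (n - 1)) g) \<le> B" using iterate by blast
    have "dist x y \<le> B" if "x \<in> carrier G" "y \<in> carrier G" "dist (\<phi> x) (\<phi> y) \<le> r" for x y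
    proof -
      have "len ((\<phi> ^^ (n - 1)) (\<phi> (inv x \<otimes> y))) \<le> B"
        using B that d[of x y] \<phi>.hom_closed[of "inv x \<otimes> y"] by auto
      then show ?thesis using that inverse[of "inv x \<otimes> y"] by (simp add: dist_def)
    qed
    then show ?thesis by blast
  qed
  ultimately show ?thesis by (auto simp: coarse_embedding_def)
qed

text \<open>
  Within one coset \<open>K \<otimes> s\<close> the cocycle takes only finitely many values up to replacing \<open>g\<close> by
  \<open>g \<otimes> k\<close> with \<open>k \<in> K\<close>.  Let \<open>\<theta>\<close> be the conjugate of \<open>\<phi>\<close> by \<open>g\<close>; it has finite order, and as \<open>s\<close>
  and \<open>\<phi>\<close> commensurate \<open>K\<close>, it maps some power \<open>a^P\<close> to \<open>a^P\<close> or to its inverse.  The exponent \<open>P\<close>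
  depends on \<open>s\<close> only.  If \<open>\<theta>\<close> inverts \<open>a^P\<close>, then passing from \<open>g\<close> to \<open>g \<otimes> a^(- P * m)\<close>
  multiplies the cocycle value by \<open>a^(2 * P * m)\<close>.  If \<open>\<theta>\<close> fixes \<open>a^P\<close>, then two cocycle values
  that differ by a power of \<open>a^P\<close> are equal, because \<open>\<phi>\<close> has finite order.
\<close>

lemma cocycle_values_mod:
  assumes p: "p > 0" and comm: "\<phi> a [^] (p::int) \<in> K" and s: "s \<in> carrier G"
  obtains M :: int where "M > 0"
    "\<And>g g' i j. g \<in> carrier G \<Longrightarrow> g' \<in> carrier G \<Longrightarrow> inv g \<otimes> \<phi> g = a [^] i \<otimes> s \<Longrightarrow>
      inv g' \<otimes> \<phi> g' = a [^] j \<otimes> s \<Longrightarrow> M dvd j - i \<Longrightarrow>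
      \<exists>k\<in>K. g' \<otimes> inv (g \<otimes> k) \<in> Fix G \<phi>"
proof -
  obtain q :: int where q: "\<phi> (a [^] p) = a [^] q"
    using comm K_eq by (auto simp: \<phi>.hom_int_pow)
  have abs_q: "\<bar>p\<bar> = \<bar>q\<bar>"
    by (rule periodic_exponent[OF \<phi>_hom period_pos _ q]) (simp add: periodic)
  obtain N L :: int where NL: "N > 0" "L \<noteq> 0" "s \<otimes> a [^] N \<otimes> inv s = a [^] L"
    by (rule commensurated[OF s])
  define P where "P = p * N"
  have Ppos: "P > 0" using p NL(1) by (simp add: P_def)
  have "\<exists>k\<in>K. g' \<otimes> inv (g \<otimes> k) \<in> Fix G \<phi>"
    if g: "g \<in> carrier G" and g': "g' \<in> carrier G" and z: "inv g \<otimes> \<phi> g = a [^] i \<otimes> s"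
      and z': "inv g' \<otimes> \<phi> g' = a [^] j \<otimes> s" and dvd: "2 * P dvd j - i" for g g' i j
  proof -
    obtain m where m: "j - i = 2 * P * m" using dvd by (elim dvdE)
    define \<theta> where "\<theta> x = inv g \<otimes> \<phi> (g \<otimes> x \<otimes> inv g) \<otimes> g" for x
    have \<theta>_hom: "\<theta> \<in> hom G G"
      using g by (auto simp: hom_def \<theta>_def free_reduce)
    interpret \<theta>: group_hom G G \<theta> by unfold_locales (rule \<theta>_hom)
    have "(\<theta> ^^ l) x = inv g \<otimes> (\<phi> ^^ l) (g \<otimes> x \<otimes> inv g) \<otimes> g" if "x \<in> carrier G" for l x
      using g that funpow_closed[OF \<phi>_hom]
      by (induction l) (auto simp: \<theta>_def free_reduce)
    then have \<theta>_per: "(\<theta> ^^ n) (a [^] l) = a [^] l" for l :: int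
      using g periodic by (simp add: free_reduce)
    have \<phi>g: "\<phi> g = g \<otimes> (a [^] i \<otimes> s)"
      using z g s by (metis \<phi>.hom_closed a_carrier int_pow_closed inv_closed inv_solve_left' m_closed)
    have \<theta>_eq: "\<theta> x = (a [^] i \<otimes> s) \<otimes> \<phi> x \<otimes> inv (a [^] i \<otimes> s)" if "x \<in> carrier G" for x
      using that g s by (simp add: \<theta>_def \<phi>g free_reduce)
    have "\<phi> (a [^] P) = a [^] (q * N)"
      unfolding P_def by (metis \<phi>.hom_int_pow a_carrier int_pow_closed int_pow_pow q)
    have sq: "s \<otimes> a [^] (q * N) \<otimes> inv s = a [^] (q * L)"
      using conj_int_pow[OF s, of "a [^] N" q] NL(3) by (simp add: int_pow_pow mult.commute)
    have "\<theta> (a [^] P) = a [^] i \<otimes> (s \<otimes> a [^] (q * N) \<otimes> inv s) \<otimes> inv (a [^] i)"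
      using s \<open>\<phi> (a [^] P) = a [^] (q * N)\<close> by (simp add: \<theta>_eq free_reduce)
    also have "\<dots> = a [^] (q * L) \<otimes> a [^] i \<otimes> inv (a [^] i)"
      unfolding sq by (simp only: int_pow_mult[OF a_carrier, symmetric] add.commute)
    also have "\<dots> = a [^] (q * L)" by (simp add: m_assoc)
    finally have \<theta>P: "\<theta> (a [^] P) = a [^] (q * L)" .
    have "\<bar>P\<bar> = \<bar>q * L\<bar>"
      by (rule periodic_exponent[OF \<theta>_hom period_pos \<theta>_per \<theta>P])
    then consider (pos) "q * L = P" | (neg) "q * L = - P" by linarith
    then show ?thesis
    proof cases
      case pos
      define r where "r = j - i"
      have r: "r = P * (2 * m)" using m by (simp add: r_def)
      have \<theta>r: "\<theta> (a [^] r) = a [^] r"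
        unfolding r using \<theta>P pos by (metis \<theta>.hom_int_pow a_carrier int_pow_closed int_pow_pow)
      define c where "c = g \<otimes> a [^] r \<otimes> inv g"
      \<comment> \<open>\<open>\<phi>\<close> fixes \<open>c\<close> and multiplies \<open>y\<close> by \<open>c\<close>, so periodicity forces \<open>c^n = \<one>\<close>.\<close>
      define y where "y = g' \<otimes> inv g"
      have cG: "c \<in> carrier G" and yG: "y \<in> carrier G" using g g' by (simp_all add: c_def y_def)
      have \<phi>c: "\<phi> c = c"
      proof -
        have "\<phi> c = g \<otimes> \<theta> (a [^] r) \<otimes> inv g"
          using g by (simp add: c_def \<theta>_def free_reduce)
        then show ?thesis by (simp add: \<theta>r c_def)
      qed
      have \<phi>g': "\<phi> g' = g' \<otimes> (a [^] j \<otimes> s)"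
        using z' g' s by (metis \<phi>.hom_closed a_carrier int_pow_closed inv_closed inv_solve_left' m_closed)
      have \<phi>y: "\<phi> y = y \<otimes> c"
      proof -
        have "a [^] j = a [^] r \<otimes> a [^] i" by (simp add: r_def flip: int_pow_mult)
        then show ?thesis using g g' s by (simp add: y_def c_def \<phi>g \<phi>g' free_reduce)
      qed
      have "(\<phi> ^^ l) y = y \<otimes> c [^] l" for l :: nat
      proof (induction l)
        case (Suc l)
        then show ?case using cG yG \<phi>c \<phi>y
          by (simp add: \<phi>.hom_nat_pow m_assoc nat_pow_comm)
            (metis m_assoc nat_pow_Suc nat_pow_Suc2)
      qed (use yG in simp)
      then have "y \<otimes> c [^] n = y" using periodic[OF yG] by metis
      then have cn: "c [^] n = \<one>" using cG yG by (simp add: r_cancel_one')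
      have "c [^] int n = g \<otimes> a [^] (r * int n) \<otimes> inv g"
        using conj_int_pow[OF g, of "a [^] r" "int n"] by (simp add: c_def int_pow_pow)
      then have "g \<otimes> a [^] (r * int n) \<otimes> inv g = \<one>" using cn by (simp add: int_pow_int)
      moreover have "a [^] (r * int n) = inv g \<otimes> (g \<otimes> a [^] (r * int n) \<otimes> inv g) \<otimes> g"
        using g by (simp add: free_reduce)
      ultimately have "a [^] (r * int n) = \<one>" using g by simp
      then have "r = 0" using infinite_order[of "r * int n"] period_pos by simp
      then have "inv g \<otimes> \<phi> g = inv g' \<otimes> \<phi> g'" using z z' by (simp add: r_def)
      then have "g' \<otimes> inv (g \<otimes> \<one>) \<in> Fix G \<phi>" using same_cocycle_value g g' by simp
      then show ?thesis using subgroup.one_closed[OF K_subgroup] by blast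
    next
      case neg
      define k where "k = a [^] (- (P * m))"
      have k: "k \<in> K" "k \<in> carrier G" by (auto simp: k_def K_eq)
      have "k = (a [^] P) [^] (- m)" by (simp add: k_def int_pow_pow)
      then have "\<theta> k = (a [^] (- P)) [^] (- m)"
        using \<theta>.hom_int_pow[of "a [^] P" "- m"] \<theta>P neg by simp
      then have "\<theta> k = a [^] (P * m)"
        using int_pow_pow[OF a_carrier, of "- P" "- m"] by simp
      moreover have "inv g \<otimes> \<phi> (g \<otimes> k) = \<theta> k \<otimes> (inv g \<otimes> \<phi> g)"
        using g k by (simp add: \<theta>_def free_reduce)
      moreover have "inv (g \<otimes> k) \<otimes> \<phi> (g \<otimes> k) = inv k \<otimes> (inv g \<otimes> \<phi> (g \<otimes> k))"
        using g k by (simp add: free_reduce)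
      ultimately have "inv (g \<otimes> k) \<otimes> \<phi> (g \<otimes> k) = inv k \<otimes> (a [^] (P * m) \<otimes> (inv g \<otimes> \<phi> g))"
        by simp
      also have "\<dots> = a [^] (P * m) \<otimes> (a [^] (P * m) \<otimes> (a [^] i \<otimes> s))"
        unfolding z by (simp add: k_def int_pow_neg)
      also have "\<dots> = (a [^] (P * m) \<otimes> (a [^] (P * m) \<otimes> a [^] i)) \<otimes> s"
        using s by (simp add: m_assoc)
      also have "a [^] (P * m) \<otimes> (a [^] (P * m) \<otimes> a [^] i) = a [^] (P * m + (P * m + i))"
        by (simp only: int_pow_mult[OF a_carrier])
      also have "P * m + (P * m + i) = j" using m by (simp add: algebra_simps)
      finally have "inv (g \<otimes> k) \<otimes> \<phi> (g \<otimes> k) = inv g' \<otimes> \<phi> g'" using z' by simp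
      then show ?thesis using same_cocycle_value[of "g \<otimes> k" g'] g g' k by blast
    qed
  qed
  then show ?thesis using that[of "2 * P"] Ppos by simp
qed

end

section \<open>The fixed subgroup in the commensurable case\<close>

context periodic_endomorphism
begin

text \<open>
  Small displacement confines the cocycle value to finitely many cosets \<open>K \<otimes> inv s\<close>.  An element
  is classified by such an \<open>s\<close> and the exponent of \<open>a\<close> modulo the number supplied by
  \<open>cocycle_values_mod\<close>; one representative per class suffices.
\<close>

lemma small_displacement_cofinite:
  assumes p: "p > 0" and comm: "\<phi> a [^] (p::int) \<in> K"
  obtains Q where "finite Q" "Q \<subseteq> carrier G"
    "\<And>g. g \<in> carrier G \<Longrightarrow> dist g (\<phi> g) \<le> R \<Longrightarrow> \<exists>q\<in>Q. \<exists>k\<in>K. g \<otimes> inv (q \<otimes> k) \<in> Fix G \<phi>"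
proof -
  define Y where "Y = {g \<in> carrier G. dist g (\<phi> g) \<le> R}"
  obtain S where S: "finite S" "S \<subseteq> carrier G"
    "\<And>g. g \<in> carrier G \<Longrightarrow> len g \<le> R \<Longrightarrow> \<exists>s\<in>S. len (inv s \<otimes> g) = 0"
    using balls[of R] by blast
  have "\<exists>M::int. M > 0 \<and> (\<forall>g g' i j. g \<in> carrier G \<longrightarrow> g' \<in> carrier G \<longrightarrow>
      inv g \<otimes> \<phi> g = a [^] i \<otimes> inv s \<longrightarrow> inv g' \<otimes> \<phi> g' = a [^] j \<otimes> inv s \<longrightarrow> M dvd j - i \<longrightarrow>
      (\<exists>k\<in>K. g' \<otimes> inv (g \<otimes> k) \<in> Fix G \<phi>))" (is "\<exists>M. ?good s M") if "s \<in> S" for s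
  proof -
    have "inv s \<in> carrier G" using that S by blast
    from cocycle_values_mod[OF p comm this] obtain M :: int where "M > 0"
      "\<And>g g' i j. g \<in> carrier G \<Longrightarrow> g' \<in> carrier G \<Longrightarrow> inv g \<otimes> \<phi> g = a [^] i \<otimes> inv s \<Longrightarrow>
        inv g' \<otimes> \<phi> g' = a [^] j \<otimes> inv s \<Longrightarrow> M dvd j - i \<Longrightarrow>
        \<exists>k\<in>K. g' \<otimes> inv (g \<otimes> k) \<in> Fix G \<phi>" by blast
    then show ?thesis by blast
  qed
  then obtain M where "\<forall>s\<in>S. ?good s (M s)" using bchoice[of S ?good] by blast
  then have M: "\<And>s. s \<in> S \<Longrightarrow> M s > 0"
    "\<And>s g g' i j. s \<in> S \<Longrightarrow> g \<in> carrier G \<Longrightarrow> g' \<in> carrier G \<Longrightarrow>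
      inv g \<otimes> \<phi> g = a [^] i \<otimes> inv s \<Longrightarrow> inv g' \<otimes> \<phi> g' = a [^] j \<otimes> inv s \<Longrightarrow> M s dvd j - i \<Longrightarrow>
      \<exists>k\<in>K. g' \<otimes> inv (g \<otimes> k) \<in> Fix G \<phi>"
    by blast+
  have "\<exists>s\<in>S. \<exists>i::int. inv g \<otimes> \<phi> g = a [^] i \<otimes> inv s" if g: "g \<in> Y" for g
  proof -
    let ?z = "inv g \<otimes> \<phi> g"
    have gG: "g \<in> carrier G" using g by (simp add: Y_def)
    have zG: "?z \<in> carrier G" using gG by simp
    have "len (inv ?z) \<le> R" using g len_inv[OF zG] by (simp add: Y_def dist_def)
    then obtain s where s: "s \<in> S" "len (inv s \<otimes> inv ?z) = 0"
      using S(3)[of "inv ?z"] zG by auto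
    have sG: "s \<in> carrier G" using s S by blast
    then obtain i :: int where i: "inv s \<otimes> inv ?z = a [^] i"
      using s(2) zG len_zero[of "inv s \<otimes> inv ?z"] by auto
    have "?z = inv (inv s \<otimes> inv ?z) \<otimes> inv s"
      using sG gG by (simp add: free_reduce)
    also have "\<dots> = a [^] (- i) \<otimes> inv s" unfolding i by (simp add: int_pow_neg)
    finally show ?thesis using s(1) by blast
  qed
  then have "\<forall>g\<in>Y. \<exists>v. fst v \<in> S \<and> inv g \<otimes> \<phi> g = a [^] (snd v :: int) \<otimes> inv (fst v)" by auto
  then obtain v where v: "\<And>g. g \<in> Y \<Longrightarrow> fst (v g) \<in> S"
    "\<And>g. g \<in> Y \<Longrightarrow> inv g \<otimes> \<phi> g = a [^] (snd (v g) :: int) \<otimes> inv (fst (v g))"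
    using bchoice[of Y "\<lambda>g v. fst v \<in> S \<and> inv g \<otimes> \<phi> g = a [^] (snd v :: int) \<otimes> inv (fst v)"] by blast
  define f where "f g = (fst (v g), snd (v g) mod M (fst (v g)))" for g
  have "f ` Y \<subseteq> (SIGMA s:S. {0..<M s})"
    using v(1) M(1) by (auto simp: f_def)
  moreover have "finite (SIGMA s:S. {0..<M s})" using S(1) by auto
  ultimately have "finite (f ` Y)" by (rule finite_subset)
  then obtain Q where Q: "Q \<subseteq> Y" "finite Q" "f ` Y = f ` Q"
    using finite_subset_image[of "f ` Y" f Y] by auto
  have "\<exists>q\<in>Q. \<exists>k\<in>K. g \<otimes> inv (q \<otimes> k) \<in> Fix G \<phi>" if g: "g \<in> carrier G" "dist g (\<phi> g) \<le> R" for g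
  proof -
    have gY: "g \<in> Y" using g by (simp add: Y_def)
    then obtain q where q: "q \<in> Q" "f q = f g" using Q(3) by (metis image_eqI imageE)
    have qY: "q \<in> Y" "q \<in> carrier G" using q(1) Q(1) by (auto simp: Y_def)
    have same: "fst (v q) = fst (v g)"
      and "snd (v g) mod M (fst (v g)) = snd (v q) mod M (fst (v g))"
      using q(2) by (auto simp: f_def)
    then have "M (fst (v g)) dvd snd (v g) - snd (v q)" by (simp add: mod_eq_dvd_iff)
    then have "\<exists>k\<in>K. g \<otimes> inv (q \<otimes> k) \<in> Fix G \<phi>"
      using M(2)[OF v(1)[OF gY] qY(2) g(1)] v(2)[OF qY(1)] v(2)[OF gY] same by simp
    then show ?thesis using q(1) by blast
  qed
  then show ?thesis using that[OF Q(2)] Q(1) by (auto simp: Y_def)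
qed

text \<open>
  Every point of a path near the geodesic from \<open>\<one>\<close> to a fixed element \<open>h\<close> has bounded
  displacement, so it is within distance \<open>m\<close> of a fixed element.  Fixed elements attached to
  consecutive points of the path differ by a fixed element of length at most \<open>E\<close>.
\<close>

theorem Fix_finitely_generated_if_commensurable:
  assumes p: "p > 0" and comm: "\<phi> a [^] (p::int) \<in> K"
  shows "finitely_generated (G\<lparr>carrier := Fix G \<phi>\<rparr>)"
proof -
  let ?H = "Fix G \<phi>"
  have HG: "h \<in> carrier G" and H\<phi>: "\<phi> h = h" if "h \<in> ?H" for h using that by (auto simp: Fix_def)
  note H_mult = subgroup.m_closed[OF Fix_subgroup] and H_inv = subgroup.m_inv_closed[OF Fix_subgroup]
  obtain S where gens: "finite S" "S \<subseteq> carrier G" "generate G S = carrier G"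
    using finitely_generated by blast
  obtain D C where DC: "D \<ge> 0" "C \<ge> 0"
    "\<And>x y. x \<in> carrier G \<Longrightarrow> y \<in> carrier G \<Longrightarrow>
      (x, y) \<in> (steps D {u \<in> carrier G. between C x u y})\<^sup>*"
    using steps_connected_between[OF gens] by blast
  obtain R where R: "\<And>x g y. x \<in> carrier G \<Longrightarrow> g \<in> carrier G \<Longrightarrow> y \<in> carrier G \<Longrightarrow> \<phi> x = x \<Longrightarrow>
      \<phi> y = y \<Longrightarrow> between C x g y \<Longrightarrow> dist g (\<phi> g) \<le> R"
    using periodic_displacement_bounded[OF gens \<phi>_coarse_embedding[OF p comm] period_pos periodic]
    by blast
  obtain Q where Q: "finite Q" "Q \<subseteq> carrier G" "\<And>g. g \<in> carrier G \<Longrightarrow> dist g (\<phi> g) \<le> R \<Longrightarrow>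
      \<exists>q\<in>Q. \<exists>k\<in>K. g \<otimes> inv (q \<otimes> k) \<in> ?H"
    using small_displacement_cofinite[OF p comm] by blast
  define m where "m = (\<Sum>q\<in>Q. len q)"
  have m: "len q \<le> m" if "q \<in> Q" for q
    unfolding m_def by (rule member_le_sum) (use that Q len_nonneg in auto)
  have m0: "m \<ge> 0" unfolding m_def by (rule sum_nonneg) (use Q len_nonneg in auto)
  define E where "E = D + 2 * m"
  define Y where "Y = {h \<in> ?H. len h \<le> E}"
  have YG: "Y \<subseteq> carrier G" using HG by (auto simp: Y_def)
  note gen_subgroup = generate_is_subgroup[OF YG]
  have close: "inv h \<otimes> h' \<in> generate G Y"
    if "h \<in> ?H" "h' \<in> ?H" "u \<in> carrier G" "u' \<in> carrier G" "dist u u' \<le> D"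
      "dist h u \<le> m" "dist h' u' \<le> m" for h h' u u'
  proof -
    have G: "h \<in> carrier G" "h' \<in> carrier G" using that HG by auto
    have "dist h h' \<le> E"
      using dist_triangle[OF G(1) that(3) G(2)] dist_triangle[OF that(3,4) G(2)]
        dist_commute[OF that(4) G(2)] that(5-7) unfolding E_def by linarith
    then show ?thesis
      using H_mult[OF H_inv[OF that(1)] that(2)] by (intro generate.incl) (simp add: Y_def dist_def)
  qed
  have "?H \<subseteq> generate G Y"
  proof
    fix h assume h: "h \<in> ?H"
    let ?A = "{u \<in> carrier G. between C \<one> u h}"
    have near: "\<exists>h'\<in>?H. dist h' u \<le> m" if u: "u \<in> ?A" for u
    proof -
      have uG: "u \<in> carrier G" using u by simp
      have "dist u (\<phi> u) \<le> R" by (rule R[of \<one> u h]) (use u h HG H\<phi> in auto)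
      then obtain q k where qk: "q \<in> Q" "k \<in> K" "u \<otimes> inv (q \<otimes> k) \<in> ?H"
        using Q(3)[OF uG] by blast
      have G: "q \<in> carrier G" "k \<in> carrier G" using qk Q by (auto simp: K_def)
      have "dist (u \<otimes> inv (q \<otimes> k)) u = len (q \<otimes> k)"
        using G uG by (simp add: dist_def free_reduce)
      also have "\<dots> \<le> len q" using len_mult_K G qk by blast
      finally have "dist (u \<otimes> inv (q \<otimes> k)) u \<le> m" using m[OF qk(1)] by linarith
      then show ?thesis using qk(3) by blast
    qed
    have chain: "\<forall>h'\<in>?H. dist h' u \<le> m \<longrightarrow> h' \<in> generate G Y" if "(\<one>, u) \<in> (steps D ?A)\<^sup>*" for u
      using that
    proof (induction rule: rtrancl_induct)
      case base
      have "h' \<in> generate G Y" if "h' \<in> ?H" "dist h' \<one> \<le> m" for h'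
        using close[of \<one> h' \<one> \<one>] that m0 DC(1) HG subgroup.one_closed[OF Fix_subgroup]
        by (simp add: dist_self)
      then show ?case by blast
    next
      case (step u u')
      then have u: "u \<in> ?A" "u' \<in> ?A" "dist u u' \<le> D" by (auto simp: steps_def)
      obtain h1 where h1: "h1 \<in> ?H" "dist h1 u \<le> m" using near[OF u(1)] by blast
      have h1Y: "h1 \<in> generate G Y" using step.IH h1 by blast
      have "h' \<in> generate G Y" if h': "h' \<in> ?H" "dist h' u' \<le> m" for h'
      proof -
        have "inv h1 \<otimes> h' \<in> generate G Y" using close[of h1 h' u u'] h1 h' u by auto
        then have "h1 \<otimes> (inv h1 \<otimes> h') \<in> generate G Y" using h1Y by (rule generate.eng[rotated])
        then show ?thesis using HG[OF h1(1)] HG[OF h'(1)] by (simp add: free_reduce)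
      qed
      then show ?case by blast
    qed
    show "h \<in> generate G Y"
      using chain[OF DC(3)[OF one_closed HG[OF h]]] h m0 dist_self[OF HG[OF h]] by auto
  qed
  obtain T where T: "finite T" "T \<subseteq> carrier G"
    "\<And>g. g \<in> carrier G \<Longrightarrow> len g \<le> E \<Longrightarrow> \<exists>s\<in>T. len (inv s \<otimes> g) = 0"
    using balls[of E] by blast
  show ?thesis
  proof (rule finitely_generated_by_cosets[OF Fix_subgroup K_subgroup T(1,2)])
    show "Y \<subseteq> ?H" by (auto simp: Y_def)
    show "?H \<subseteq> generate G Y" by fact
    show "\<exists>s\<in>T. inv s \<otimes> x \<in> K" if "x \<in> Y" for x
    proof -
      have x: "x \<in> carrier G" "len x \<le> E" using that YG by (auto simp: Y_def)
      obtain s where "s \<in> T" "len (inv s \<otimes> x) = 0" using T(3)[OF x] by blast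
      moreover from this have "inv s \<otimes> x \<in> carrier G" using T(2) x(1) by blast
      ultimately show ?thesis unfolding K_def by blast
    qed
    show "finitely_generated (G\<lparr>carrier := ?H \<inter> K\<rparr>)"
      by (rule finitely_generated_subgroup_cyclic[OF a_carrier subgroups_Inter_pair[OF Fix_subgroup K_subgroup]])
        (auto simp: K_eq)
  qed
qed

end

section \<open>The case of a hyperbolic image of the vertex stabiliser\<close>

context lyndon_length
begin

lemma dist_pow:
  assumes "b \<in> carrier G"
  shows "dist (b [^] (i::int)) (b [^] (j::int)) = len (b [^] (j - i))"
  using int_pow_mult[OF assms, of "- i" j] assms by (simp add: dist_def int_pow_neg)

lemma len_pow_abs:
  assumes "b \<in> carrier G"
  shows "len (b [^] (i::int)) = len (b [^] \<bar>i\<bar>)"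
  using assms by (cases "i \<ge> 0") (simp_all add: int_pow_neg len_inv)

text \<open>
  If \<open>len (b^2) \<le> len b\<close>, then in the tree the midpoint between the base point and its image is
  moved to itself, so all powers move the base point by at most \<open>len b\<close>.
\<close>

lemma len_pow_bounded_if_elliptic:
  assumes b: "b \<in> carrier G" and ell: "len (b [^] (2::int)) \<le> len b"
  shows "len (b [^] int k) \<le> len b"
proof (induction k rule: less_induct)
  case (less k)
  consider "k = 0" | "k = 1" | "k \<ge> 2" by linarith
  then show ?case
  proof cases
    case 1
    then show ?thesis using b by (simp add: len_one len_nonneg)
  next
    case 2
    then show ?thesis using b by simp
  next
    case 3
    have k1: "int k - 1 = int (k - 1)" and k2: "int k - 2 = int (k - 2)" using 3 by simp_all
    have d: "dist \<one> (b [^] i) = len (b [^] i)" "dist b (b [^] i) = len (b [^] (i - 1))"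
      "dist (b [^] i) (b [^] (2::int)) = len (b [^] (i - 2))" for i :: int
      using dist_pow[OF b, of 0 i] dist_pow[OF b, of 1 i] dist_pow[OF b, of 2 i] b
        dist_commute[of "b [^] i" "b [^] (2::int)"] by simp_all
    have "len (b [^] int k) + len b \<le> len b + len (b [^] (int k - 2)) \<or>
        len (b [^] int k) + len b \<le> len (b [^] (2::int)) + len (b [^] (int k - 1))"
      using four_point_cases[of \<one> b "b [^] int k" "b [^] (2::int)"] b d(1)[of 1] d(2)[of 2]
      by (simp add: d)
    then show ?thesis using less[of "k - 1"] less[of "k - 2"] 3 ell unfolding k1 k2 by auto
  qed
qed

text \<open>
  The number \<open>len (b^2) - len b\<close> is the translation length of \<open>b\<close>.  The four point condition for
  \<open>\<one>, b, b^(k-1), b^k\<close> says that the lengths of the powers form an arithmetic progression.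
\<close>

lemma len_pow_if_hyperbolic:
  assumes b: "b \<in> carrier G" and hyp: "len b < len (b [^] (2::int))" and k: "k \<ge> 1"
  shows "len (b [^] int k) = len b + (int k - 1) * (len (b [^] (2::int)) - len b)"
  using k
proof (induction k rule: less_induct)
  case (less k)
  let ?t = "len (b [^] (2::int)) - len b"
  consider "k = 1" | "k = 2" | "k \<ge> 3" using less.prems by linarith
  then show ?case
  proof cases
    case 1
    then show ?thesis using b by simp
  next
    case 2
    then show ?thesis using b by simp
  next
    case 3
    define j where "j = int k"
    have j: "j \<ge> 3" using 3 by (simp add: j_def)
    have k1: "len (b [^] (j - 1)) = len b + (j - 2) * ?t"
      using less.IH[of "k - 1"] 3 by (simp add: j_def of_nat_diff)
    have k2: "len (b [^] (j - 2)) = len b + (j - 3) * ?t"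
      using less.IH[of "k - 2"] 3 by (simp add: j_def of_nat_diff)
    have big: "len b < len (b [^] (j - 1))"
      unfolding k1 using j hyp by simp
    have d: "dist \<one> (b [^] i) = len (b [^] i)" "dist b (b [^] i) = len (b [^] (i - 1))"
      "dist (b [^] i) b = len (b [^] (i - 1))" for i :: int
      using dist_pow[OF b, of 0 i] dist_pow[OF b, of 1 i] b dist_commute[of b "b [^] i"]
      by simp_all
    have dl: "dist (b [^] j) (b [^] (j - 1)) = len b" "dist (b [^] (j - 1)) (b [^] j) = len b"
      using dist_pow[OF b, of "j - 1" j] b dist_commute[of "b [^] j" "b [^] (j - 1)"] by simp_all
    have "dist \<one> b = len b" using d(1)[of 1] b by simp
    note d = d dl this
    have "2 * len (b [^] (j - 1)) \<le> 2 * len b \<or>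
        2 * len (b [^] (j - 1)) \<le> len (b [^] j) + len (b [^] (j - 2))"
      using four_point_cases[of \<one> b "b [^] (j - 1)" "b [^] j"] b by (simp add: d)
    moreover have "len (b [^] j) + len (b [^] (j - 2)) \<le> 2 * len b \<or>
        len (b [^] j) + len (b [^] (j - 2)) \<le> 2 * len (b [^] (j - 1))"
      using four_point_cases[of \<one> b "b [^] j" "b [^] (j - 1)"] b by (simp add: d)
    ultimately have "len (b [^] j) = 2 * len (b [^] (j - 1)) - len (b [^] (j - 2))"
      using big by linarith
    also have "\<dots> = len b + (j - 1) * ?t"
      unfolding k1 k2 by (simp add: algebra_simps)
    finally show ?thesis by (simp add: j_def)
  qed
qed

text \<open>
  Let \<open>\<one>\<close> be a point of the orbit of \<open>\<langle>c\<rangle>\<close> nearest to \<open>g\<close>.  The four point condition bounds the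
  distances of \<open>g\<close> from \<open>c^m\<close> and \<open>c^(- m)\<close> from below in terms of \<open>len g\<close>.  On the other hand their sum is at
  most twice the displacement \<open>len (c^m)\<close>, because \<open>g\<close> is moved by \<open>c^m\<close> as far as \<open>\<one>\<close>.  The last
  assumption puts the projection of \<open>g\<close> to the axis on one side of \<open>c\<close>; replacing \<open>c\<close> by \<open>inv c\<close>
  covers the other side.
\<close>

lemma near_axis_aux:
  fixes m :: int
  assumes c: "c \<in> carrier G" and g: "g \<in> carrier G"
    and disp: "len (inv g \<otimes> c [^] m \<otimes> g) = len (c [^] m)"
    and least: "\<And>j::int. len g \<le> dist (c [^] j) g"
    and m: "len g \<le> len (c [^] m)" "len (c [^] (m - 1)) < len (c [^] m)"
    and side: "len g < dist c g"
  shows "len g \<le> len c"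
proof -
  let ?F = "\<lambda>j::int. dist (c [^] j) g"
  have cG: "c [^] (j::int) \<in> carrier G" for j using c by simp
  have d1: "dist \<one> (c [^] j) = len (c [^] j)" "dist (c [^] j) \<one> = len (c [^] j)" for j :: int
    using dist_pow[OF c, of 0 j] dist_commute[OF one_closed cG[of j]] by simp_all
  have d2: "dist c (c [^] m) = len (c [^] (m - 1))" "dist (c [^] m) c = len (c [^] (m - 1))"
    using dist_pow[OF c, of 1 m] c dist_commute[OF c cG[of m]] by simp_all
  have d3: "dist (c [^] (- m)) (inv c) = len (c [^] (m - 1))"
    "dist (inv c) (c [^] (- m)) = len (c [^] (m - 1))"
    using dist_pow[OF c, of "- m" "- 1"] c dist_commute[of "inv c" "c [^] (- m)"]
    by (simp_all add: int_pow_neg)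
  have d4: "dist (inv c) \<one> = len c" "dist \<one> (inv c) = len c" "dist \<one> c = len c"
    using c dist_one_left[of c] dist_one_left[of "inv c"] dist_commute[of "inv c" \<one>]
    by (simp_all add: len_inv)
  have dg: "dist \<one> g = len g" "dist g \<one> = len g" using g dist_one_left dist_commute by auto
  have inv_len: "len (c [^] (- m)) = len (c [^] m)"
    using c by (simp add: int_pow_neg len_inv)
  have "dist (c [^] (- m)) g = dist \<one> (c [^] m \<otimes> g)"
    using dist_left_mult[of "c [^] m" "c [^] (- m)" g] c g by (simp add: int_pow_neg)
  then have d5: "dist \<one> (c [^] m \<otimes> g) = ?F (- m)" by simp
  have d6: "dist (c [^] m) (c [^] m \<otimes> g) = len g" "dist (c [^] m \<otimes> g) (c [^] m) = len g"
    using dist_left_mult[of "c [^] m" \<one> g] c g dg dist_commute[of "c [^] m" "c [^] m \<otimes> g"] by simp_all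
  have "dist g (c [^] m \<otimes> g) = len (c [^] m)"
    using disp c g by (simp add: dist_def m_assoc)
  then have d7: "dist (c [^] m \<otimes> g) g = len (c [^] m)"
    using dist_commute[of g "c [^] m \<otimes> g"] c g by simp
  have upper: "?F (- m) + ?F m \<le> 2 * len (c [^] m)"
    using four_point_cases[of \<one> "c [^] m" "c [^] m \<otimes> g" g] c g m(1)
    by (auto simp add: d1 d5 d6 d7 dg)
  have "len (c [^] m) + dist c g \<le> len c + ?F m"
    using four_point_cases[of \<one> c "c [^] m" g] c g m(2) side by (simp add: d1 d2 d4 dg)
  moreover have inv_side: "len g \<le> dist (inv c) g"
    using least[of "- 1"] c by (simp add: int_pow_neg)
  moreover have "len (c [^] m) + dist (inv c) g \<le> len c + ?F (- m)"
    using four_point_cases[of "c [^] (- m)" "inv c" \<one> g] c g m(2) inv_side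
    by (auto simp add: d1 d3 d4 dg inv_len)
  ultimately show ?thesis using upper side by linarith
qed

text \<open>
  In a tree a hyperbolic \<open>c\<close> moves a point by its translation length plus twice the distance to
  its axis.  So a point that is moved as far as the base point is at the same distance from the axis.
\<close>

lemma near_axis:
  assumes c: "c \<in> carrier G" and g: "g \<in> carrier G"
    and hyp: "len c < len (c [^] (2::int))"
    and disp: "\<And>k::int. len (inv g \<otimes> c [^] k \<otimes> g) = len (c [^] k)"
  obtains j :: int where "len (c [^] j \<otimes> g) \<le> len c"
proof -
  have "\<exists>j0::int. \<forall>j::int. nat (len (c [^] j0 \<otimes> g)) \<le> nat (len (c [^] j \<otimes> g))"
    using ex_has_least_nat[of "\<lambda>_. True" "0::int" "\<lambda>j. nat (len (c [^] j \<otimes> g))"] by simp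
  then obtain j0 :: int where min: "\<And>j::int. nat (len (c [^] j0 \<otimes> g)) \<le> nat (len (c [^] j \<otimes> g))" by blast
  have j0: "len (c [^] j0 \<otimes> g) \<le> len (c [^] j \<otimes> g)" for j :: int
    using min[of j] len_nonneg[of "c [^] j \<otimes> g"] c g by (simp add: nat_le_eq_zle)
  define h where "h = c [^] j0 \<otimes> g"
  have h: "h \<in> carrier G" using c g by (simp add: h_def)
  have conj: "inv h \<otimes> c [^] k \<otimes> h = inv g \<otimes> c [^] k \<otimes> g" for k :: int
  proof -
    have "c [^] (j0 + k) = c [^] (k + j0)" by (simp add: add.commute)
    then have "c [^] k \<otimes> c [^] j0 = c [^] j0 \<otimes> c [^] k" using c by (simp add: int_pow_mult)
    then have "c [^] k \<otimes> (c [^] j0 \<otimes> g) = c [^] j0 \<otimes> (c [^] k \<otimes> g)"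
      using c g by (metis int_pow_closed m_assoc)
    then show ?thesis using c g by (simp add: h_def free_reduce)
  qed
  have least: "len h \<le> dist (c [^] j) h" for j :: int
  proof -
    have "dist (c [^] j) h = len (c [^] (- j + j0) \<otimes> g)"
      using int_pow_mult[OF c, of "- j" j0] c g
      by (simp add: dist_def h_def int_pow_neg m_assoc)
    then show ?thesis using j0 by (simp add: h_def)
  qed
  \<comment> \<open>Any \<open>m \<ge> 2\<close> with \<open>len h \<le> len (c^m)\<close> will do for \<open>near_axis_aux\<close>.\<close>
  define m where "m = nat (len h) + 2"
  have lm: "len (c [^] int m) = len c + (int m - 1) * (len (c [^] (2::int)) - len c)"
    by (rule len_pow_if_hyperbolic[OF c hyp]) (simp add: m_def)
  have lm1: "len (c [^] int (m - 1)) = len c + (int (m - 1) - 1) * (len (c [^] (2::int)) - len c)"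
    by (rule len_pow_if_hyperbolic[OF c hyp]) (simp add: m_def)
  have m1: "int m - 1 = int (m - 1)" by (simp add: m_def)
  have "len h \<le> len c + z" if "(int m - 1) * 1 \<le> z" for z
    using that len_nonneg[OF c] len_nonneg[OF h] by (simp add: m_def)
  moreover have "(int m - 1) * 1 \<le> (int m - 1) * (len (c [^] (2::int)) - len c)"
    by (rule mult_left_mono) (use hyp in \<open>auto simp: m_def\<close>)
  ultimately have big: "len h \<le> len (c [^] int m)"
    unfolding lm by blast
  have "len (c [^] int m) = len (c [^] int (m - 1)) + (len (c [^] (2::int)) - len c)"
    unfolding lm lm1 by (simp add: m_def algebra_simps)
  then have incr: "len (c [^] (int m - 1)) < len (c [^] int m)"
    unfolding m1 using hyp by simp
  have "len h \<le> len c"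
  proof (rule ccontr)
    assume contra: "\<not> len h \<le> len c"
    have "\<not> len h < dist c h"
      using near_axis_aux[OF c h _ least big incr] conj disp contra by auto
    moreover have "\<not> len h < dist (inv c) h"
    proof -
      have p: "inv c [^] (j::int) = c [^] (- j)" for j
        using c by (simp add: int_pow_inv int_pow_neg)
      have l: "len (c [^] (- j)) = len (c [^] j)" for j :: int
        using c by (simp add: int_pow_neg len_inv)
      have "len (c [^] (1 - int m)) = len (c [^] (int m - 1))" using l[of "int m - 1"] by simp
      then show ?thesis
        using near_axis_aux[of "inv c" h "int m"] c h conj disp least big incr contra
        by (auto simp: p l len_inv)
    qed
    ultimately have "dist c h \<le> len h" "dist (inv c) h \<le> len h" by auto
    \<comment> \<open>The points \<open>inv c\<close>, \<open>\<one>\<close>, \<open>c\<close> advance along the axis, so \<open>h\<close> is further from \<open>inv c\<close> or from \<open>c\<close> than from \<open>\<one>\<close>.\<close>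
    moreover have "len (c [^] (2::int)) + len h \<le> len c + dist c h \<or>
        len (c [^] (2::int)) + len h \<le> dist (inv c) h + len c"
    proof -
      have "dist (inv c) c = len (c [^] (2::int))" "dist c \<one> = len c" "dist (inv c) \<one> = len c"
        "dist \<one> c = len c" "dist \<one> h = len h"
        using dist_pow[OF c, of "-1" 1] c h dist_one_left dist_commute[of c \<one>]
          dist_commute[of "inv c" \<one>] len_inv[OF c]
        by (simp_all add: int_pow_neg)
      then show ?thesis
        using four_point_cases[of "inv c" \<one> c h] c h by simp
    qed
    ultimately show False using hyp by linarith
  qed
  then show ?thesis using that h_def by blast
qed

end

context periodic_endomorphism
begin

lemma \<phi>_preimage:
  assumes "g \<in> carrier G"
  obtains g' where "g' \<in> carrier G" "\<phi> g' = g"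
proof -
  have "\<phi> ((\<phi> ^^ (n - 1)) g) = g"
    using periodic[OF assms] period_pos by (cases n) auto
  then show ?thesis using that funpow_closed[OF \<phi>_hom assms] by blast
qed

lemma \<phi>_inj:
  assumes "x \<in> carrier G" "y \<in> carrier G" "\<phi> x = \<phi> y"
  shows "x = y"
proof -
  have "(\<phi> ^^ n) x = (\<phi> ^^ n) y" using assms(3) period_pos by (cases n) (auto simp: funpow_swap1)
  then show ?thesis using periodic assms by simp
qed

text \<open>
  Otherwise all powers of \<open>\<phi> a\<close> lie in one ball, and two of them differ by an element of \<open>K\<close>.
\<close>

lemma hyperbolic_if_not_commensurable:
  assumes nc: "\<And>p::int. p > 0 \<Longrightarrow> \<phi> a [^] p \<notin> K"
  shows "len (\<phi> a) < len (\<phi> a [^] (2::int))"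
proof (rule ccontr)
  assume "\<not> len (\<phi> a) < len (\<phi> a [^] (2::int))"
  then have "len (\<phi> a [^] int k) \<le> len (\<phi> a)" for k
    by (intro len_pow_bounded_if_elliptic) auto
  note bounded = this
  obtain i j where ij: "i < j" "inv (\<phi> a [^] int i) \<otimes> \<phi> a [^] int j \<in> K"
    by (rule pigeonhole_ball[of "\<lambda>k. \<phi> a [^] int k" "len (\<phi> a)"])
      (use bounded in auto)
  have "inv (\<phi> a [^] int i) \<otimes> \<phi> a [^] int j = \<phi> a [^] (int j - int i)"
    using int_pow_mult[of "\<phi> a" "- int i" "int j"] by (simp add: int_pow_neg)
  then show False using nc[of "int j - int i"] ij by simp
qed

text \<open>
  Applying \<open>\<phi>\<close> to the commensuration of \<open>\<langle>a\<rangle>\<close> shows that \<open>g\<close> conjugates some \<open>b^N\<close> to some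
  \<open>b^L\<close>.  Conjugation by \<open>g\<close> changes lengths by at most \<open>2 * len g\<close>, while the lengths of the
  powers \<open>b^(N * k)\<close> and \<open>b^(L * k)\<close> grow linearly in \<open>k\<close> with slopes proportional to the absolute
  values of \<open>N\<close> and \<open>L\<close>.
\<close>

lemma conj_hyperbolic_power:
  assumes nc: "\<And>p::int. p > 0 \<Longrightarrow> \<phi> a [^] p \<notin> K" and g: "g \<in> carrier G"
  obtains N :: int where "N > 0" "g \<otimes> \<phi> a [^] N \<otimes> inv g \<in> {\<phi> a [^] N, \<phi> a [^] (- N)}"
proof -
  let ?b = "\<phi> a"
  have b: "?b \<in> carrier G" by simp
  obtain g' where g': "g' \<in> carrier G" "\<phi> g' = g" using \<phi>_preimage[OF g] .
  obtain N L :: int where NL: "N > 0" "L \<noteq> 0" "g' \<otimes> a [^] N \<otimes> inv g' = a [^] L"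
    by (rule commensurated[OF g'(1)])
  have "\<phi> (g' \<otimes> a [^] N \<otimes> inv g') = \<phi> (a [^] L)" using NL(3) by simp
  then have eq: "g \<otimes> ?b [^] N \<otimes> inv g = ?b [^] L"
    using g' by (simp add: \<phi>.hom_int_pow)
  let ?t = "len (?b [^] (2::int)) - len ?b"
  have t: "?t > 0" using hyperbolic_if_not_commensurable[OF nc] by simp
  have tl: "len (?b [^] (i * int k)) = len ?b + (\<bar>i\<bar> * int k - 1) * ?t" if "i \<noteq> 0" "k \<ge> 1" for i k
  proof -
    have "\<bar>i * int k\<bar> = int (nat \<bar>i\<bar> * k)" by (simp add: abs_mult)
    moreover have "nat \<bar>i\<bar> * k \<ge> 1" using that by simp
    ultimately show ?thesis
      using len_pow_abs[OF b, of "i * int k"] len_pow_if_hyperbolic[OF b, of "nat \<bar>i\<bar> * k"] t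
      by simp
  qed
  have conj_k: "?b [^] (L * int k) = g \<otimes> ?b [^] (N * int k) \<otimes> inv g" for k
    using conj_int_pow[OF g, of "?b [^] N" "int k"] eq by (simp add: int_pow_pow)
  have len_conj: "len (x \<otimes> y \<otimes> inv x) \<le> len y + 2 * len x"
    if "x \<in> carrier G" "y \<in> carrier G" for x y
    using len_mult[of "x \<otimes> y" "inv x"] len_mult[of x y] that by (simp add: len_inv)
  have le1: "len (?b [^] (L * int k)) \<le> len (?b [^] (N * int k)) + 2 * len g" for k
    using len_conj[OF g, of "?b [^] (N * int k)"] conj_k[of k] by simp
  have le2: "len (?b [^] (N * int k)) \<le> len (?b [^] (L * int k)) + 2 * len g" for k
  proof -
    have "inv g \<otimes> ?b [^] (L * int k) \<otimes> inv (inv g) = ?b [^] (N * int k)"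
      unfolding conj_k using g by (simp add: free_reduce)
    then show ?thesis using len_conj[of "inv g" "?b [^] (L * int k)"] g by (simp add: len_inv)
  qed
  have "\<bar>\<bar>L\<bar> - \<bar>N\<bar>\<bar> * (int k * ?t) \<le> 2 * len g" if "k \<ge> 1" for k
  proof -
    have "\<bar>(\<bar>L\<bar> * int k - 1) * ?t - (\<bar>N\<bar> * int k - 1) * ?t\<bar> \<le> 2 * len g"
      using le1[of k] le2[of k] tl[of L k] tl[of N k] NL that by linarith
    moreover have "(\<bar>L\<bar> * int k - 1) * ?t - (\<bar>N\<bar> * int k - 1) * ?t = (\<bar>L\<bar> - \<bar>N\<bar>) * (int k * ?t)"
      by (simp add: algebra_simps)
    moreover have "\<bar>(\<bar>L\<bar> - \<bar>N\<bar>) * (int k * ?t)\<bar> = \<bar>\<bar>L\<bar> - \<bar>N\<bar>\<bar> * (int k * ?t)"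
      using t by (simp add: abs_mult)
    ultimately show ?thesis by simp
  qed
  from this[of "nat (2 * len g) + 1"]
  have bound: "\<bar>\<bar>L\<bar> - \<bar>N\<bar>\<bar> * ((2 * len g + 1) * ?t) \<le> 2 * len g"
    using len_nonneg[OF g] by (simp add: algebra_simps)
  have "\<bar>L\<bar> = \<bar>N\<bar>"
  proof (rule ccontr)
    assume "\<bar>L\<bar> \<noteq> \<bar>N\<bar>"
    then have "1 \<le> \<bar>\<bar>L\<bar> - \<bar>N\<bar>\<bar>" by linarith
    moreover have "2 * len g + 1 \<le> (2 * len g + 1) * ?t"
      using mult_left_mono[of 1 ?t "2 * len g + 1"] t len_nonneg[OF g] by simp
    ultimately have "1 * (2 * len g + 1) \<le> \<bar>\<bar>L\<bar> - \<bar>N\<bar>\<bar> * ((2 * len g + 1) * ?t)"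
      using len_nonneg[OF g] by (intro mult_mono) auto
    then show False using bound by simp
  qed
  then have "L = N \<or> L = - N" by linarith
  then show ?thesis using that[OF NL(1)] eq by auto
qed

text \<open>
  A common multiple \<open>m\<close> of the exponents for finitely many generators serves all of \<open>G\<close>, so
  \<open>c = (\<phi> a)^m\<close> generates a normal subgroup; as \<open>\<phi>\<close> is injective and maps \<open>d = a^m\<close> to \<open>c\<close>, so does
  \<open>d\<close>.  The product of these two normal subgroups has finite index: up to powers of \<open>c\<close> on the left
  every element has length at most \<open>len c\<close> by \<open>near_axis\<close>, and balls are finite up to powers of \<open>d\<close>
  on the right.
\<close>

theorem subgroups_finitely_generated_if_not_commensurable:
  assumes nc: "\<And>p::int. p > 0 \<Longrightarrow> \<phi> a [^] p \<notin> K" and H: "subgroup H G"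
  shows "finitely_generated (G\<lparr>carrier := H\<rparr>)"
proof -
  let ?b = "\<phi> a"
  obtain S where gens: "finite S" "S \<subseteq> carrier G" "generate G S = carrier G"
    using finitely_generated by blast
  have "\<forall>s\<in>S. \<exists>N::int. N > 0 \<and> s \<otimes> ?b [^] N \<otimes> inv s \<in> {?b [^] N, ?b [^] (- N)}"
    using conj_hyperbolic_power[OF nc] gens(2) by (metis subsetD)
  then obtain N :: "'g \<Rightarrow> int" where N: "\<And>s. s \<in> S \<Longrightarrow> N s > 0"
    "\<And>s. s \<in> S \<Longrightarrow> s \<otimes> ?b [^] N s \<otimes> inv s \<in> {?b [^] N s, ?b [^] (- N s)}"
    by (metis bchoice)
  define m where "m = (\<Prod>s\<in>S. N s)"
  have m: "m > 0" unfolding m_def by (rule prod_pos) (use N in auto)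
  define c where "c = ?b [^] m"
  have c: "c \<in> carrier G" by (simp add: c_def)
  have conj_S: "s \<otimes> c \<otimes> inv s \<in> {c, inv c}" if s: "s \<in> S" for s
  proof -
    obtain q where q: "m = N s * q" unfolding m_def using prod.remove[OF gens(1) s, of N] by auto
    have "s \<otimes> c \<otimes> inv s = (s \<otimes> ?b [^] N s \<otimes> inv s) [^] q"
      using conj_int_pow[of s "?b [^] N s" q] s gens(2) by (auto simp: c_def q int_pow_pow)
    moreover have "(?b [^] N s) [^] q = c" "(?b [^] (- N s)) [^] q = inv c"
      using int_pow_neg[of ?b "N s * q"] by (simp_all add: c_def q int_pow_pow)
    ultimately show ?thesis using N(2)[OF s] by auto
  qed
  have conj_c: "g \<otimes> c \<otimes> inv g \<in> {c, inv c}" if "g \<in> carrier G" for g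
  proof -
    have inv_case: "inv g \<otimes> c \<otimes> g \<in> {c, inv c}"
      if g: "g \<in> carrier G" and e: "g \<otimes> c \<otimes> inv g \<in> {c, inv c}" for g
    proof -
      consider "g \<otimes> c \<otimes> inv g = c" | "g \<otimes> c \<otimes> inv g = inv c" using e by auto
      then show ?thesis
      proof cases
        case 1
        have "inv g \<otimes> (g \<otimes> c \<otimes> inv g) \<otimes> g = c" using g c by (simp add: free_reduce)
        then show ?thesis using 1 by simp
      next
        case 2
        have "inv g \<otimes> inv (g \<otimes> c \<otimes> inv g) \<otimes> g = inv c" using g c by (simp add: free_reduce)
        then show ?thesis using 2 c by simp
      qed
    qed
    have "g \<in> generate G S" using that gens(3) by simp
    then show ?thesis
    proof (induction rule: generate.induct)
      case one
      then show ?case using c by simp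
    next
      case (incl h)
      then show ?case by (rule conj_S)
    next
      case (inv h)
      then have "h \<in> carrier G" using gens(2) by blast
      then show ?case using inv_case[OF _ conj_S[OF inv]] by simp
    next
      case (eng h1 h2)
      have h: "h1 \<in> carrier G" "h2 \<in> carrier G" using eng.hyps gens(3) by auto
      have split: "h1 \<otimes> h2 \<otimes> c \<otimes> inv (h1 \<otimes> h2) = h1 \<otimes> (h2 \<otimes> c \<otimes> inv h2) \<otimes> inv h1"
        using h c by (simp add: free_reduce)
      have "h1 \<otimes> inv c \<otimes> inv h1 = inv (h1 \<otimes> c \<otimes> inv h1)"
        using h c by (simp add: free_reduce)
      then show ?case unfolding split using eng.IH c by auto
    qed
  qed
  have c_hyp: "len c < len (c [^] (2::int))"
  proof -
    have "len ?b < len (?b [^] (2::int))" by (rule hyperbolic_if_not_commensurable[OF nc])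
    moreover have "?b [^] m = ?b [^] int (nat m)" "c [^] (2::int) = ?b [^] int (2 * nat m)"
      using m by (simp_all add: c_def int_pow_pow mult.commute)
    ultimately show ?thesis
      using len_pow_if_hyperbolic[of ?b "nat m"] len_pow_if_hyperbolic[of ?b "2 * nat m"] m
      by (simp add: c_def)
  qed
  have c_disp: "len (inv g \<otimes> c [^] k \<otimes> g) = len (c [^] k)" if g: "g \<in> carrier G" for g and k :: int
  proof -
    have "inv g \<otimes> c [^] k \<otimes> g = (inv g \<otimes> c \<otimes> inv (inv g)) [^] k"
      using conj_int_pow[of "inv g" c k] g c by simp
    then show ?thesis
      using conj_c[of "inv g"] g c by (auto simp: int_pow_inv len_inv)
  qed
  define d where "d = a [^] m"
  have d: "d \<in> carrier G" by (simp add: d_def)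
  have \<phi>d: "\<phi> d = c" by (simp add: d_def c_def \<phi>.hom_int_pow)
  have conj_d: "g \<otimes> d \<otimes> inv g \<in> {d, inv d}" if g: "g \<in> carrier G" for g
  proof -
    have "\<phi> (g \<otimes> d \<otimes> inv g) \<in> {\<phi> d, \<phi> (inv d)}"
      using conj_c[of "\<phi> g"] g d by (simp add: \<phi>d)
    then show ?thesis using \<phi>_inj[of "g \<otimes> d \<otimes> inv g"] g d by blast
  qed
  have cyclic_normal: "range (\<lambda>i::int. x [^] i) \<lhd> G"
    if x: "x \<in> carrier G" and conj: "\<And>g. g \<in> carrier G \<Longrightarrow> g \<otimes> x \<otimes> inv g \<in> {x, inv x}" for x
  proof -
    have "range (\<lambda>i::int. x [^] i) = generate G {x}"
      using generate_pow[OF x] by auto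
    then have sub: "subgroup (range (\<lambda>i::int. x [^] i)) G"
      using generate_is_subgroup[of "{x}"] x by simp
    have "g \<otimes> x [^] i \<otimes> inv g \<in> range (\<lambda>i::int. x [^] i)" if g: "g \<in> carrier G" for g and i :: int
    proof -
      have "g \<otimes> x [^] i \<otimes> inv g = (g \<otimes> x \<otimes> inv g) [^] i" using conj_int_pow[OF g x] by simp
      moreover have "inv x [^] i = x [^] (- i)" using x by (simp add: int_pow_inv int_pow_neg)
      ultimately show ?thesis using conj[OF g] by auto
    qed
    then show ?thesis using sub by (auto simp: normal_inv_iff)
  qed
  let ?C = "range (\<lambda>i::int. c [^] i)" and ?D = "range (\<lambda>i::int. d [^] i)"
  have C: "?C \<lhd> G" and D: "?D \<lhd> G" using cyclic_normal c d conj_c conj_d by blast+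
  have Dsub: "subgroup ?D G" using D by (simp add: normal_inv_iff)
  have CD: "subgroup (?C <#> ?D) G" by (rule mult_norm_subgroup[OF C Dsub])
  obtain T where T: "finite T" "T \<subseteq> carrier G"
    "\<And>g. g \<in> carrier G \<Longrightarrow> len g \<le> len c \<Longrightarrow> \<exists>s\<in>T. len (inv s \<otimes> g) = 0"
    using balls[of "len c"] by blast
  define T' where "T' = (\<lambda>(t, i). t \<otimes> a [^] i) ` (T \<times> {0..<m})"
  have cosets: "\<exists>s\<in>T'. inv s \<otimes> h \<in> ?C <#> ?D" if h: "h \<in> carrier G" for h
  proof -
    obtain j :: int where j: "len (c [^] j \<otimes> h) \<le> len c"
      using near_axis[OF c h c_hyp c_disp[OF h]] .
    then obtain t where t: "t \<in> T" "len (inv t \<otimes> (c [^] j \<otimes> h)) = 0"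
      using T(3)[of "c [^] j \<otimes> h"] c h by auto
    have tG: "t \<in> carrier G" using t T by blast
    then obtain i :: int where i: "inv t \<otimes> (c [^] j \<otimes> h) = a [^] i"
      using t(2) len_zero[of "inv t \<otimes> (c [^] j \<otimes> h)"] c h by auto
    let ?s = "t \<otimes> a [^] (i mod m)"
    have s: "?s \<in> T'" "?s \<in> carrier G" using t(1) tG m by (auto simp: T'_def)
    have "a [^] i = a [^] (i mod m) \<otimes> d [^] (i div m)"
      using int_pow_mult[of a "i mod m" "m * (i div m)"] by (simp add: d_def int_pow_pow)
    moreover have "h = inv (c [^] j) \<otimes> (t \<otimes> (inv t \<otimes> (c [^] j \<otimes> h)))"
      using c h tG by (simp add: free_reduce)
    ultimately have "h = inv (c [^] j) \<otimes> (t \<otimes> (a [^] (i mod m) \<otimes> d [^] (i div m)))"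
      using i by simp
    then have "inv ?s \<otimes> h = (inv ?s \<otimes> inv (c [^] j) \<otimes> ?s) \<otimes> d [^] (i div m)"
      using tG c d s(2) by (simp add: m_assoc)
    moreover have "inv ?s \<otimes> inv (c [^] j) \<otimes> ?s \<in> ?C"
    proof -
      have "inv (c [^] j) \<in> ?C" using c by (auto simp: int_pow_neg[symmetric])
      then have "inv ?s \<otimes> inv (c [^] j) \<otimes> inv (inv ?s) \<in> ?C"
        using C s(2) unfolding normal_inv_iff by blast
      then show ?thesis using s(2) by simp
    qed
    ultimately have "inv ?s \<otimes> h \<in> ?C <#> ?D" unfolding set_mult_def by blast
    then show ?thesis using s(1) by blast
  qed
  show ?thesis
  proof (rule finitely_generated_by_cosets[OF H CD])
    show "finite T'" using T(1) by (simp add: T'_def)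
    show "T' \<subseteq> carrier G" using T(2) by (auto simp: T'_def)
    show "H \<subseteq> H" "H \<subseteq> generate G H" by (auto intro: generate.incl)
    show "\<exists>s\<in>T'. inv s \<otimes> x \<in> ?C <#> ?D" if "x \<in> H" for x
      using cosets subgroup.mem_carrier[OF H that] by blast
    show "finitely_generated (G\<lparr>carrier := H \<inter> (?C <#> ?D)\<rparr>)"
    proof (rule finitely_generated_cyclic_extension[OF Dsub c])
      show "c \<otimes> u \<otimes> inv c \<in> ?D" if "u \<in> ?D" for u
        using D c that unfolding normal_inv_iff by blast
      show "inv c \<otimes> u \<otimes> c \<in> ?D" if "u \<in> ?D" for u
      proof -
        have "inv c \<otimes> u \<otimes> inv (inv c) \<in> ?D" using D c that unfolding normal_inv_iff by blast
        then show ?thesis using c by simp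
      qed
      show "finitely_generated (G\<lparr>carrier := H'\<rparr>)" if "subgroup H' G" "H' \<subseteq> ?D" for H'
        using finitely_generated_subgroup_cyclic[OF d that] .
      show "subgroup (H \<inter> (?C <#> ?D)) G" using H CD by (rule subgroups_Inter_pair)
      show "\<exists>i::int. \<exists>u\<in>?D. h = c [^] i \<otimes> u" if "h \<in> H \<inter> (?C <#> ?D)" for h
        using that unfolding set_mult_def by blast
    qed
  qed
qed

theorem Fix_finitely_generated: "finitely_generated (G\<lparr>carrier := Fix G \<phi>\<rparr>)"
  using Fix_finitely_generated_if_commensurable
    subgroups_finitely_generated_if_not_commensurable[OF _ Fix_subgroup] by blast

end

section \<open>Length functions from actions on trees\<close>

context serre_tree
begin

text \<open>
  Walks without backtracking.
\<close>

definition reduced :: "'e list \<Rightarrow> bool" where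
  "reduced p \<longleftrightarrow> successively (\<lambda>e f. f \<noteq> arev e) p"

definition rwalk :: "'v \<Rightarrow> 'e list \<Rightarrow> 'v \<Rightarrow> bool" where
  "rwalk u p v \<longleftrightarrow> awalk u p v \<and> reduced p"

abbreviation reverse :: "'e list \<Rightarrow> 'e list" where
  "reverse p \<equiv> rev (map arev p)"

lemma arev_neq_iff: "e \<noteq> arev f \<longleftrightarrow> f \<noteq> arev e"
  by (metis arev_arev)

lemma reduced_reverse: "reduced (reverse p) \<longleftrightarrow> reduced p"
  unfolding reduced_def by (simp add: successively_map arev_neq_iff eq_commute)

lemma reduced_append:
  "reduced (p @ q) \<longleftrightarrow> reduced p \<and> reduced q \<and> (p = [] \<or> q = [] \<or> hd q \<noteq> arev (last p))"
  unfolding reduced_def by (simp add: successively_append_iff)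

lemma awalk_appendE:
  assumes "awalk u (p @ q) v"
  obtains w where "awalk u p w" "awalk w q v"
  using assms that[of "awlast u p"] by simp

lemma awalk_single: "awalk u [e] v \<longleftrightarrow> e \<in> arcs T \<and> u = tail T e \<and> v = head T e"
  by (auto simp: awalk_simps)

lemma awalk_reverse: "awalk u p v \<Longrightarrow> awalk v (reverse p) u"
proof (induction p arbitrary: u)
  case Nil
  then show ?case by (auto simp: awalk_simps)
next
  case (Cons e p)
  then have e: "e \<in> arcs T" "u = tail T e" "awalk (head T e) p v" by (simp_all add: awalk_simps)
  have "awalk (head T e) [arev e] u" using e by (simp add: awalk_single)
  then show ?case using awalk_appendI[OF Cons.IH[OF e(3)]] by simp
qed

text \<open>
  Deleting backtrackings from a walk does not introduce new arcs.
\<close>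

lemma rwalk_exists:
  assumes "awalk u p v"
  obtains q where "rwalk u q v" "set q \<subseteq> set p"
proof -
  from assms have "\<exists>q. rwalk u q v \<and> set q \<subseteq> set p"
  proof (induction p arbitrary: v rule: rev_induct)
    case Nil
    then show ?case by (auto simp: rwalk_def reduced_def)
  next
    case (snoc e p)
    then obtain w where w: "awalk u p w" "awalk w [e] v" by (blast elim: awalk_appendE)
    then obtain q where q: "rwalk u q w" "set q \<subseteq> set p" using snoc.IH by blast
    have e: "e \<in> arcs T" "w = tail T e" "v = head T e" using w(2) by (simp_all add: awalk_single)
    show ?case
    proof (cases "q \<noteq> [] \<and> last q = arev e")
      case True
      then obtain q' where q': "q = q' @ [arev e]" by (metis append_butlast_last_id)
      then obtain w' where w': "awalk u q' w'" "awalk w' [arev e] w"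
        using q(1) unfolding rwalk_def by (blast elim: awalk_appendE)
      then have "w' = v" using e by (simp add: awalk_single)
      then have "rwalk u q' v" using q(1) w' unfolding rwalk_def q' by (simp add: reduced_append)
      then show ?thesis using q(2) q' by auto
    next
      case False
      have "awalk u (q @ [e]) v" using q(1) w(2) awalk_appendI unfolding rwalk_def by blast
      moreover have "reduced (q @ [e])"
        using False q(1) unfolding reduced_append rwalk_def
        by (auto simp: reduced_def)
      ultimately show ?thesis using q(2) unfolding rwalk_def by (intro exI[of _ "q @ [e]"]) auto
    qed
  qed
  then show ?thesis using that by blast
qed

text \<open>
  A shortest nonempty closed walk without backtracking visits no vertex twice, so it is a cycle;
  but the cycles \<open>[b, arev b]\<close> of a tree are backtrackings.
\<close>

lemma closed_rwalk_Nil: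
  assumes "rwalk u p u"
  shows "p = []"
  using assms
proof (induction "length p" arbitrary: u p rule: less_induct)
  case less
  show ?case
  proof (rule ccontr)
    assume "p \<noteq> []"
    then obtain e p' where p: "p = e # p'" by (cases p) auto
    have walk: "awalk u p u" and red: "reduced p" using less.prems by (simp_all add: rwalk_def)
    show False
    proof (cases "distinct (tl (awalk_verts u p))")
      case True
      then have "cycle p" using walk \<open>p \<noteq> []\<close> unfolding cycle_def by blast
      then obtain b where "p = [b, arev b]" using no_circuit by blast
      then show False using red by (simp add: reduced_def)
    next
      case False
      have walk': "awalk (head T e) p' u" using walk unfolding p by (auto simp: awalk_simps)
      have "\<not> distinct (awalk_verts (head T e) p')" using False unfolding p by simp
      then obtain q r s w where d: "p' = q @ r @ s" "0 < length r" "awalk w r w"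
        using awalk_not_distinct_decomp[OF walk'] by blast
      have "reduced ([e] @ q @ r @ s)" using red unfolding p d by simp
      then have "reduced r" by (simp only: reduced_append)
      then have "r = []" using less.hyps[of r w] d p by (simp add: rwalk_def)
      then show False using d by simp
    qed
  qed
qed

text \<open>
  If two walks without backtracking have different last arcs, then the first one followed by the
  reverse of the second one is a closed walk without backtracking.
\<close>

lemma rwalk_unique:
  assumes "rwalk u p v" "rwalk u q v"
  shows "p = q"
  using assms
proof (induction p arbitrary: q v rule: rev_induct)
  case Nil
  then have "u = v" by (simp add: rwalk_def awalk_simps)
  then show ?case using Nil closed_rwalk_Nil by blast
next
  case (snoc e p)
  have "q \<noteq> []"
  proof
    assume "q = []"
    then have "u = v" using snoc.prems(2) by (simp add: rwalk_def awalk_simps)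
    then show False using closed_rwalk_Nil snoc.prems(1) by blast
  qed
  then obtain f q' where q: "q = q' @ [f]" by (metis append_butlast_last_id)
  obtain w where w: "awalk u p w" "awalk w [e] v"
    using snoc.prems(1) unfolding rwalk_def by (blast elim: awalk_appendE)
  obtain w' where w': "awalk u q' w'" "awalk w' [f] v"
    using snoc.prems(2) unfolding rwalk_def q by (blast elim: awalk_appendE)
  have red: "reduced (p @ [e])" "reduced q" using snoc.prems by (simp_all add: rwalk_def)
  have "e = f"
  proof (rule ccontr)
    assume "e \<noteq> f"
    have "awalk u ((p @ [e]) @ reverse q) u"
      using awalk_appendI[of u "p @ [e]" v "reverse q" u] awalk_reverse snoc.prems
      unfolding rwalk_def by blast
    moreover have "reduced ((p @ [e]) @ reverse q)"
      unfolding reduced_append[of "p @ [e]"] reduced_reverse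
      using red \<open>e \<noteq> f\<close> by (simp add: q arev_eq_iff)
    ultimately have "(p @ [e]) @ reverse q = []"
      using closed_rwalk_Nil unfolding rwalk_def by blast
    then show False by simp
  qed
  moreover from this have "w = w'" using w w' by (simp add: awalk_single)
  moreover have "reduced p" "reduced q'" using red unfolding q reduced_append by simp_all
  ultimately show ?case using snoc.IH[of w q'] w w' unfolding rwalk_def q by blast
qed

lemma awalk_between:
  assumes "u \<in> verts T" "v \<in> verts T"
  obtains p where "awalk u p v"
proof -
  have "symmetric T" by (rule sym_arcs)
  moreover have "u \<rightarrow>\<^sup>*\<^bsub>with_proj (mk_symmetric T)\<^esub> v"
    using connected assms unfolding connected_def by (auto elim!: strongly_connectedE)
  ultimately have "u \<rightarrow>\<^sup>*\<^bsub>T\<^esub> v" by (simp add: reachable_mk_symmetric_eq)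
  then show ?thesis using that reachable_awalk by blast
qed

definition path :: "'v \<Rightarrow> 'v \<Rightarrow> 'e list" where
  "path u v = (THE p. rwalk u p v)"

lemma path_eq: "rwalk u p v \<Longrightarrow> path u v = p"
  unfolding path_def using rwalk_unique by blast

lemma rwalk_path:
  assumes "u \<in> verts T" "v \<in> verts T"
  shows "rwalk u (path u v) v"
  using awalk_between[OF assms] rwalk_exists path_eq by metis

lemma set_path_subset: "awalk u p v \<Longrightarrow> set (path u v) \<subseteq> set p"
  using rwalk_exists path_eq by metis

end

lemma longest_common_prefix_split:
  obtains p' q' where "p = longest_common_prefix p q @ p'" "q = longest_common_prefix p q @ q'"
    "p' = [] \<or> q' = [] \<or> hd p' \<noteq> hd q'"
proof -
  have "\<exists>p' q'. p = longest_common_prefix p q @ p' \<and> q = longest_common_prefix p q @ q' \<and>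
      (p' = [] \<or> q' = [] \<or> hd p' \<noteq> hd q')"
    by (induction p q rule: longest_common_prefix.induct) auto
  then show ?thesis using that by blast
qed

text \<open>
  This is where hyperbolicity of trees comes from: the length of the longest common prefix of two
  reduced walks from the base point is the Gromov product of their ends.
\<close>

lemma longest_common_prefix_ultrametric:
  "min (length (longest_common_prefix p q)) (length (longest_common_prefix q r))
    \<le> length (longest_common_prefix p r)"
proof (induction p q arbitrary: r rule: longest_common_prefix.induct)
  case (1 x xs y ys)
  then show ?case by (cases r) auto
qed auto

sublocale tree_action \<subseteq> grp: group G
  by (rule group_hom.axioms(1)[OF V.group_hom])

context tree_action
begin

lemma arcs_act_inj: "\<lbrakk>g \<in> carrier G; e \<in> arcs T; f \<in> arcs T; \<beta> g e = \<beta> g f\<rbrakk> \<Longrightarrow> e = f"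
  using E.inj_prop by (simp add: inj_on_def)

lemma awalk_act:
  assumes g: "g \<in> carrier G"
  shows "awalk u p v \<Longrightarrow> awalk (\<alpha> g u) (map (\<beta> g) p) (\<alpha> g v)"
proof (induction p arbitrary: u)
  case Nil
  then show ?case using V.element_image[OF g] by (auto simp: awalk_simps)
next
  case (Cons e p)
  then have e: "e \<in> arcs T" "u = tail T e" "awalk (head T e) p v" by (simp_all add: awalk_simps)
  have "\<beta> g e \<in> arcs T" using E.element_image[OF g e(1)] by simp
  then show ?case
    using Cons.IH[OF e(3)] e g by (simp add: awalk_simps tail_equivariant head_equivariant)
qed

lemma rwalk_act:
  assumes g: "g \<in> carrier G" and p: "rwalk u p v"
  shows "rwalk (\<alpha> g u) (map (\<beta> g) p) (\<alpha> g v)"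
proof -
  have "set p \<subseteq> arcs T" using p unfolding rwalk_def by blast
  have "successively (\<lambda>e f. \<beta> g f \<noteq> arev (\<beta> g e)) p"
  proof (rule successively_mono)
    show "successively (\<lambda>e f. f \<noteq> arev e) p" using p by (simp add: rwalk_def reduced_def)
    fix e f assume "e \<in> set p" "f \<in> set p" and ne: "f \<noteq> arev e"
    then have "e \<in> arcs T" "f \<in> arcs T" using \<open>set p \<subseteq> arcs T\<close> by auto
    then show "\<beta> g f \<noteq> arev (\<beta> g e)"
      using ne arcs_act_inj[OF g, of f "arev e"] arev_equivariant[OF g, of e] by auto
  qed
  then show ?thesis
    using p awalk_act[OF g] by (simp add: rwalk_def reduced_def successively_map)
qed

lemma path_act:
  assumes "g \<in> carrier G" "u \<in> verts T" "v \<in> verts T"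
  shows "path (\<alpha> g u) (\<alpha> g v) = map (\<beta> g) (path u v)"
  using assms rwalk_act rwalk_path by (intro path_eq) blast

lemma arc_stabilizer_subset:
  "e \<in> arcs T \<Longrightarrow> stabilizer G \<beta> e \<subseteq> stabilizer G \<alpha> (tail T e)"
  unfolding stabilizer_def using tail_equivariant by fastforce

end

context group
begin

lemma infinite_cyclic_subgroupE:
  assumes H: "subgroup H G" and cyc: "infinite_cyclic (G\<lparr>carrier := H\<rparr>)"
  obtains t where "t \<in> H" "H = range (\<lambda>i::int. t [^] i)" "\<And>i::int. t [^] i = \<one> \<Longrightarrow> i = 0"
proof -
  interpret H: group "G\<lparr>carrier := H\<rparr>" using H by (rule subgroup.subgroup_is_group) (rule is_group)
  have "cyclic_group (G\<lparr>carrier := H\<rparr>)" and inf: "infinite H"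
    using cyc by (simp_all add: infinite_cyclic_def)
  then obtain t where t: "t \<in> H" "H = range (\<lambda>i::int. t [^]\<^bsub>G\<lparr>carrier := H\<rparr>\<^esub> i)"
    using H.cyclic_group by auto
  have range: "H = range (\<lambda>i::int. t [^] i)"
    using t int_pow_consistent[OF H t(1)] by simp
  have tG: "t \<in> carrier G" using subgroup.mem_carrier[OF H t(1)] .
  have "i = 0" if i: "t [^] i = \<one>" for i :: int
  proof (rule ccontr)
    assume "i \<noteq> 0"
    have "t [^] j = t [^] (j mod i)" for j :: int
    proof -
      have "t [^] j = t [^] (j mod i) \<otimes> (t [^] i) [^] (j div i)"
        using int_pow_mult[OF tG, of "j mod i" "i * (j div i)"] tG by (simp add: int_pow_pow)
      then show ?thesis using i tG by simp
    qed
    moreover have "j mod i \<in> {- \<bar>i\<bar>..\<bar>i\<bar>}" for j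
      using abs_mod_less[OF \<open>i \<noteq> 0\<close>, of j] by auto
    ultimately have "t [^] j \<in> (\<lambda>i. t [^] i) ` {- \<bar>i\<bar>..\<bar>i\<bar>}" for j :: int
      by (metis imageI)
    then have "H \<subseteq> (\<lambda>i. t [^] i) ` {- \<bar>i\<bar>..\<bar>i\<bar>}"
      unfolding range by blast
    then show False using inf finite_subset by blast
  qed
  then show ?thesis using that[OF t(1) range] by blast
qed

end

context tree_action
begin

text \<open>
  Local finiteness: the arcs at \<open>v\<close> in one orbit of \<open>G\<close> form one orbit of the stabiliser of \<open>v\<close>,
  and an infinite subgroup of an infinite cyclic group has finite index.
\<close>

lemma finite_orbit_arcs_at_vertex:
  assumes edge: "\<And>e. e \<in> arcs T \<Longrightarrow> infinite_cyclic (G\<lparr>carrier := stabilizer G \<beta> e\<rparr>)"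
    and vertex: "\<And>v. v \<in> verts T \<Longrightarrow> infinite_cyclic (G\<lparr>carrier := stabilizer G \<alpha> v\<rparr>)"
    and f: "f \<in> arcs T"
  shows "finite {\<beta> g f | g. g \<in> carrier G \<and> tail T (\<beta> g f) = v}"
proof (cases "\<exists>g. g \<in> carrier G \<and> tail T (\<beta> g f) = v")
  case False
  then have "{\<beta> g f | g. g \<in> carrier G \<and> tail T (\<beta> g f) = v} = {}" by blast
  then show ?thesis by (simp only: finite.emptyI)
next
  case True
  then obtain g0 where g0: "g0 \<in> carrier G" "tail T (\<beta> g0 f) = v" by blast
  define e where "e = \<beta> g0 f"
  have e: "e \<in> arcs T" "tail T e = v" using g0 f E.element_image[OF g0(1) f] by (simp_all add: e_def)
  have v: "v \<in> verts T" using e tail_in_verts by blast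
  have stab: "subgroup (stabilizer G \<alpha> v) G" by (rule V.stabilizer_subgroup[OF v])
  obtain t where t: "t \<in> stabilizer G \<alpha> v" "stabilizer G \<alpha> v = range (\<lambda>i::int. t [^]\<^bsub>G\<^esub> i)"
    using grp.infinite_cyclic_subgroupE[OF stab vertex[OF v]] by metis
  have tG: "t \<in> carrier G" using t(1) by (simp add: stabilizer_def)
  have "infinite (stabilizer G \<beta> e)" using edge[OF e(1)] by (simp add: infinite_cyclic_def)
  then have "\<not> stabilizer G \<beta> e \<subseteq> {t [^]\<^bsub>G\<^esub> (0::int)}" using finite_subset by blast
  then obtain i :: int where i: "t [^]\<^bsub>G\<^esub> i \<in> stabilizer G \<beta> e" "i \<noteq> 0"
    using arc_stabilizer_subset[OF e(1)] unfolding e(2) t(2) by blast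
  have mod: "\<beta> (t [^]\<^bsub>G\<^esub> j) e = \<beta> (t [^]\<^bsub>G\<^esub> (j mod i)) e" for j :: int
  proof -
    have "(t [^]\<^bsub>G\<^esub> i) [^]\<^bsub>G\<^esub> (j div i) \<in> stabilizer G \<beta> e"
      using grp.subgroup_int_pow_closed[OF E.stabilizer_subgroup[OF e(1)] i(1)] .
    then have "\<beta> (t [^]\<^bsub>G\<^esub> (i * (j div i))) e = e"
      using tG by (simp add: stabilizer_def grp.int_pow_pow)
    moreover have "t [^]\<^bsub>G\<^esub> j = t [^]\<^bsub>G\<^esub> (j mod i) \<otimes>\<^bsub>G\<^esub> t [^]\<^bsub>G\<^esub> (i * (j div i))"
      using grp.int_pow_mult[OF tG, of "j mod i" "i * (j div i)"] by simp
    ultimately show ?thesis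
      using E.composition_rule[OF e(1)] tG by simp
  qed
  have bound: "j mod i \<in> {- \<bar>i\<bar>..\<bar>i\<bar>}" for j
    using abs_mod_less[OF \<open>i \<noteq> 0\<close>, of j] by auto
  have "\<beta> g f \<in> (\<lambda>j. \<beta> (t [^]\<^bsub>G\<^esub> j) e) ` {- \<bar>i\<bar>..\<bar>i\<bar>}"
    if g: "g \<in> carrier G" "tail T (\<beta> g f) = v" for g
  proof -
    let ?x = "g \<otimes>\<^bsub>G\<^esub> inv\<^bsub>G\<^esub> g0"
    have x: "?x \<in> carrier G" using g g0 by simp
    have "?x \<otimes>\<^bsub>G\<^esub> g0 = g" using g g0 by (simp add: grp.m_assoc)
    then have xe: "\<beta> ?x e = \<beta> g f" using E.composition_rule[OF f x g0(1)] by (simp add: e_def)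
    then have "\<alpha> ?x v = v" using tail_equivariant[OF x e(1)] e(2) g(2) by simp
    then have "?x \<in> stabilizer G \<alpha> v" using x by (simp add: stabilizer_def)
    then obtain j :: int where "?x = t [^]\<^bsub>G\<^esub> j" using t(2) by blast
    then have "\<beta> g f = \<beta> (t [^]\<^bsub>G\<^esub> (j mod i)) e" using xe mod by simp
    then show ?thesis using bound by blast
  qed
  then have "{\<beta> g f | g. g \<in> carrier G \<and> tail T (\<beta> g f) = v} \<subseteq> (\<lambda>j. \<beta> (t [^]\<^bsub>G\<^esub> j) e) ` {- \<bar>i\<bar>..\<bar>i\<bar>}"
    by blast
  then show ?thesis by (rule finite_subset) simp
qed

definition orbit_len :: "'v \<Rightarrow> 'g \<Rightarrow> int" where
  "orbit_len x g = int (length (path x (\<alpha> g x)))"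

text \<open>
  Removing the common initial part of the paths from \<open>x\<close> to \<open>g x\<close> and to \<open>h x\<close> leaves the path
  from \<open>g x\<close> to \<open>h x\<close>, which is a translate of the path from \<open>x\<close> to \<open>(inv g \<otimes> h) x\<close>.
\<close>

lemma orbit_len_formula:
  assumes x: "x \<in> verts T" and g: "g \<in> carrier G" and h: "h \<in> carrier G"
  shows "orbit_len x (inv\<^bsub>G\<^esub> g \<otimes>\<^bsub>G\<^esub> h) = orbit_len x g + orbit_len x h
    - 2 * int (length (longest_common_prefix (path x (\<alpha> g x)) (path x (\<alpha> h x))))"
proof -
  let ?p = "path x (\<alpha> g x)" and ?q = "path x (\<alpha> h x)"
  let ?c = "longest_common_prefix ?p ?q"
  have gx: "\<alpha> g x \<in> verts T" and hx: "\<alpha> h x \<in> verts T"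
    using V.element_image[OF g x] V.element_image[OF h x] by auto
  have p: "rwalk x ?p (\<alpha> g x)" and q: "rwalk x ?q (\<alpha> h x)" using rwalk_path x gx hx by auto
  obtain p' q' where pq: "?p = ?c @ p'" "?q = ?c @ q'" "p' = [] \<or> q' = [] \<or> hd p' \<noteq> hd q'"
    by (rule longest_common_prefix_split)
  have p2: "awalk x (?c @ p') (\<alpha> g x)" "reduced (?c @ p')"
    using p unfolding rwalk_def by (metis pq(1))+
  have q2: "awalk x (?c @ q') (\<alpha> h x)" "reduced (?c @ q')"
    using q unfolding rwalk_def by (metis pq(2))+
  have p': "awalk (awlast x ?c) p' (\<alpha> g x)" "reduced p'" using p2 by (simp_all add: reduced_append)
  have q': "awalk (awlast x ?c) q' (\<alpha> h x)" "reduced q'" using q2 by (simp_all add: reduced_append)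
  have "awalk (\<alpha> g x) (reverse p' @ q') (\<alpha> h x)"
    by (rule awalk_appendI[OF awalk_reverse[OF p'(1)] q'(1)])
  moreover have "reduced (reverse p' @ q')"
    unfolding reduced_append reduced_reverse using p'(2) q'(2) pq(3)
    by (auto simp: last_rev hd_map)
  ultimately have "path (\<alpha> g x) (\<alpha> h x) = reverse p' @ q'"
    by (intro path_eq) (simp add: rwalk_def)
  moreover have "path (\<alpha> g x) (\<alpha> h x) = map (\<beta> g) (path x (\<alpha> (inv\<^bsub>G\<^esub> g \<otimes>\<^bsub>G\<^esub> h) x))"
  proof -
    let ?k = "inv\<^bsub>G\<^esub> g \<otimes>\<^bsub>G\<^esub> h"
    have k: "?k \<in> carrier G" using g h by simp
    have "g \<otimes>\<^bsub>G\<^esub> ?k = h" using g h by (simp add: grp.free_reduce)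
    then have "\<alpha> g (\<alpha> ?k x) = \<alpha> h x" using V.composition_rule[OF x g k] by simp
    then show ?thesis using path_act[OF g x, of "\<alpha> ?k x"] V.element_image[OF k x] by auto
  qed
  ultimately have "length (path x (\<alpha> (inv\<^bsub>G\<^esub> g \<otimes>\<^bsub>G\<^esub> h) x)) = length p' + length q'"
    by (metis length_append length_map length_rev)
  moreover have "length ?p = length ?c + length p'" "length ?q = length ?c + length q'"
    by (metis pq(1) length_append, metis pq(2) length_append)
  ultimately show ?thesis by (simp add: orbit_len_def)
qed

lemma path_self: "x \<in> verts T \<Longrightarrow> path x x = []"
  by (rule path_eq) (simp add: rwalk_def awalk_simps reduced_def)

lemma act_one: "x \<in> verts T \<Longrightarrow> \<alpha> \<one>\<^bsub>G\<^esub> x = x"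
  using V.id_eq_one by (metis restrict_apply')

lemma orbit_len_one: "x \<in> verts T \<Longrightarrow> orbit_len x \<one>\<^bsub>G\<^esub> = 0"
  by (simp add: orbit_len_def act_one path_self)

lemma orbit_len_zero:
  assumes x: "x \<in> verts T" and g: "g \<in> carrier G"
  shows "orbit_len x g = 0 \<longleftrightarrow> g \<in> stabilizer G \<alpha> x"
proof -
  have "rwalk x (path x (\<alpha> g x)) (\<alpha> g x)"
    using rwalk_path x V.element_image[OF g x] by auto
  then show ?thesis
    using g path_self[OF x] by (auto simp: orbit_len_def stabilizer_def rwalk_def awalk_simps)
qed

lemma orbit_len_inv:
  assumes x: "x \<in> verts T" and g: "g \<in> carrier G"
  shows "orbit_len x (inv\<^bsub>G\<^esub> g) = orbit_len x g"
  using orbit_len_formula[OF x g grp.one_closed] g x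
  by (simp add: orbit_len_one act_one path_self)

lemma orbit_len_lyndon:
  assumes x: "x \<in> verts T"
  shows "lyndon_length G (orbit_len x)"
proof
  show "orbit_len x \<one>\<^bsub>G\<^esub> = 0" by (rule orbit_len_one[OF x])
  show "orbit_len x (inv\<^bsub>G\<^esub> g) = orbit_len x g" if "g \<in> carrier G" for g
    by (rule orbit_len_inv[OF x that])
  show "orbit_len x (g \<otimes>\<^bsub>G\<^esub> h) \<le> orbit_len x g + orbit_len x h"
    if "g \<in> carrier G" "h \<in> carrier G" for g h
    using orbit_len_formula[OF x, of "inv\<^bsub>G\<^esub> g" h] orbit_len_inv[OF x] that by simp
  fix g h k assume "g \<in> carrier G" "h \<in> carrier G" "k \<in> carrier G"
  then show "min (orbit_len x g + orbit_len x h - orbit_len x (inv\<^bsub>G\<^esub> g \<otimes>\<^bsub>G\<^esub> h))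
      (orbit_len x h + orbit_len x k - orbit_len x (inv\<^bsub>G\<^esub> h \<otimes>\<^bsub>G\<^esub> k))
      \<le> orbit_len x g + orbit_len x k - orbit_len x (inv\<^bsub>G\<^esub> g \<otimes>\<^bsub>G\<^esub> k)"
    using longest_common_prefix_ultrametric[of "path x (\<alpha> g x)" "path x (\<alpha> h x)" "path x (\<alpha> k x)"]
    by (simp add: orbit_len_formula[OF x] min_def split: if_splits)
qed

text \<open>
  The tree itself may have infinitely many orbits of arcs, but the subtree spanned by the orbit of
  \<open>x\<close> is covered by translates of the paths from \<open>x\<close> to its images under the generators.
\<close>

lemma orbit_paths_in_finitely_many_arc_orbits:
  assumes x: "x \<in> verts T" and S: "finite S" "S \<subseteq> carrier G" "generate G S = carrier G"
  obtains F where "finite F" "F \<subseteq> arcs T"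
    "\<And>g. g \<in> carrier G \<Longrightarrow> set (path x (\<alpha> g x)) \<subseteq> {\<beta> h f | h f. h \<in> carrier G \<and> f \<in> F}"
proof -
  let ?P = "\<lambda>g. path x (\<alpha> g x)"
  define F where "F = (\<Union>s\<in>S. set (?P s) \<union> arev ` set (?P s))"
  define A where "A = {\<beta> h f | h f. h \<in> carrier G \<and> f \<in> F}"
  have walk: "awalk x (?P g) (\<alpha> g x)" if "g \<in> carrier G" for g
    using rwalk_path x V.element_image[OF that x] unfolding rwalk_def by auto
  have arcs: "set (?P g) \<subseteq> arcs T" if "g \<in> carrier G" for g
    using walk[OF that] by blast
  have F: "F \<subseteq> arcs T"
  proof
    fix f assume "f \<in> F"
    then obtain s e where s: "s \<in> S" "e \<in> set (?P s)" "f = e \<or> f = arev e" by (auto simp: F_def)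
    then have "e \<in> arcs T" using arcs[of s] S(2) by blast
    then show "f \<in> arcs T" using s(3) by auto
  qed
  have A_act: "\<beta> g e \<in> A" if g: "g \<in> carrier G" and e: "e \<in> A" for g e
  proof -
    obtain h f where hf: "h \<in> carrier G" "f \<in> F" "e = \<beta> h f" using e by (auto simp: A_def)
    then have "\<beta> g e = \<beta> (g \<otimes>\<^bsub>G\<^esub> h) f" using E.composition_rule[of f g h] g F by auto
    then show ?thesis using hf g by (auto simp: A_def)
  qed
  have FA: "f \<in> A" if "f \<in> F" for f
  proof -
    have "\<beta> \<one>\<^bsub>G\<^esub> f = f" using that F E.id_eq_one by (metis restrict_apply' subsetD)
    then show ?thesis using that unfolding A_def by (metis (mono_tags, lifting) grp.one_closed mem_Collect_eq)
  qed
  have "set (?P g) \<subseteq> A" if "g \<in> generate G S" for g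
    using that
  proof (induction rule: generate.induct)
    case one
    then show ?case using x by (simp add: act_one path_self)
  next
    case (incl s)
    then show ?case using FA by (auto simp: F_def)
  next
    case (inv s)
    then have s: "s \<in> carrier G" using S by blast
    let ?s' = "inv\<^bsub>G\<^esub> s"
    have s': "?s' \<in> carrier G" using s by simp
    have "\<alpha> ?s' (\<alpha> s x) = x" using V.composition_rule[OF x s' s] s x by (simp add: act_one)
    then have "awalk x (map (\<beta> ?s') (reverse (?P s))) (\<alpha> ?s' x)"
      using awalk_act[OF s' awalk_reverse[OF walk[OF s]]] by simp
    from set_path_subset[OF this] have "set (?P ?s') \<subseteq> \<beta> ?s' ` arev ` set (?P s)"
      by simp
    moreover have "arev ` set (?P s) \<subseteq> A" using FA inv by (auto simp: F_def)
    ultimately show ?case using A_act[OF s'] by blast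
  next
    case (eng g h)
    then have gh: "g \<in> carrier G" "h \<in> carrier G" using S(3) by auto
    have "awalk (\<alpha> g x) (map (\<beta> g) (?P h)) (\<alpha> (g \<otimes>\<^bsub>G\<^esub> h) x)"
      using awalk_act[OF gh(1) walk[OF gh(2)]] V.composition_rule[OF x gh] by simp
    then have "awalk x (?P g @ map (\<beta> g) (?P h)) (\<alpha> (g \<otimes>\<^bsub>G\<^esub> h) x)"
      using walk[OF gh(1)] awalk_appendI by blast
    from set_path_subset[OF this]
    have "set (?P (g \<otimes>\<^bsub>G\<^esub> h)) \<subseteq> set (?P g) \<union> \<beta> g ` set (?P h)" by simp
    then show ?case using eng.IH A_act[OF gh(1)] by blast
  qed
  then have "set (?P g) \<subseteq> A" if "g \<in> carrier G" for g using that S(3) by simp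
  moreover have "finite F" using S(1) by (simp add: F_def)
  ultimately show ?thesis using that[of F] F by (simp add: A_def)
qed

lemma finite_walks:
  assumes "\<And>v. finite {e \<in> A. tail T e = v}"
  shows "finite {p. length p = k \<and> set p \<subseteq> A \<and> (\<exists>v. awalk x p v)}"
proof (induction k)
  case 0
  have "{p. length p = 0 \<and> set p \<subseteq> A \<and> (\<exists>v. awalk x p v)} \<subseteq> {[]}" by auto
  then show ?case by (rule finite_subset) simp
next
  case (Suc k)
  let ?W = "{p. length p = k \<and> set p \<subseteq> A \<and> (\<exists>v. awalk x p v)}"
  have "{p. length p = Suc k \<and> set p \<subseteq> A \<and> (\<exists>v. awalk x p v)}
      \<subseteq> (\<lambda>(p, e). p @ [e]) ` (SIGMA p:?W. {e \<in> A. tail T e = awlast x p})"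
  proof safe
    fix p v assume p: "length p = Suc k" "set p \<subseteq> A" "awalk x p v"
    then obtain q e where q: "p = q @ [e]" by (metis append_butlast_last_id list.size(3) nat.distinct(1))
    have w: "awalk x q (awlast x q)" "awalk (awlast x q) [e] v" using p(3) unfolding q by simp_all
    then have "tail T e = awlast x q" by (simp add: awalk_single)
    then show "p \<in> (\<lambda>(p, e). p @ [e]) ` (SIGMA p:?W. {e \<in> A. tail T e = awlast x p})"
      using p(1,2) w(1) unfolding q by (intro image_eqI[of _ _ "(q, e)"]) auto
  qed
  moreover have "finite (SIGMA p:?W. {e \<in> A. tail T e = awlast x p})"
    using Suc assms by (intro finite_SigmaI) auto
  ultimately show ?case by (rule finite_subset[OF _ finite_imageI])
qed

lemma orbit_len_balls:
  assumes edge: "\<And>e. e \<in> arcs T \<Longrightarrow> infinite_cyclic (G\<lparr>carrier := stabilizer G \<beta> e\<rparr>)"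
    and vertex: "\<And>v. v \<in> verts T \<Longrightarrow> infinite_cyclic (G\<lparr>carrier := stabilizer G \<alpha> v\<rparr>)"
    and x: "x \<in> verts T" and S: "finite S" "S \<subseteq> carrier G" "generate G S = carrier G"
  shows "\<exists>B. finite B \<and> B \<subseteq> carrier G \<and>
    (\<forall>g\<in>carrier G. orbit_len x g \<le> r \<longrightarrow> (\<exists>s\<in>B. orbit_len x (inv\<^bsub>G\<^esub> s \<otimes>\<^bsub>G\<^esub> g) = 0))"
proof -
  obtain F where F: "finite F" "F \<subseteq> arcs T"
    "\<And>g. g \<in> carrier G \<Longrightarrow> set (path x (\<alpha> g x)) \<subseteq> {\<beta> h f | h f. h \<in> carrier G \<and> f \<in> F}"
    using orbit_paths_in_finitely_many_arc_orbits[OF x S] by blast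
  define A where "A = {\<beta> h f | h f. h \<in> carrier G \<and> f \<in> F}"
  have "finite {e \<in> A. tail T e = v}" for v
  proof -
    have "{e \<in> A. tail T e = v} \<subseteq> (\<Union>f\<in>F. {\<beta> g f | g. g \<in> carrier G \<and> tail T (\<beta> g f) = v})"
      by (auto simp: A_def)
    moreover have "finite (\<Union>f\<in>F. {\<beta> g f | g. g \<in> carrier G \<and> tail T (\<beta> g f) = v})"
      using F finite_orbit_arcs_at_vertex[OF edge vertex] by blast
    ultimately show ?thesis using finite_subset by blast
  qed
  then have fin: "finite {p. length p = k \<and> set p \<subseteq> A \<and> (\<exists>v. awalk x p v)}" for k
    by (rule finite_walks)
  define Y where "Y = {g \<in> carrier G. orbit_len x g \<le> r}"
  let ?W = "\<Union>k\<in>{..nat r}. {p. length p = k \<and> set p \<subseteq> A \<and> (\<exists>v. awalk x p v)}"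
  have walk: "awalk x (path x (\<alpha> g x)) (\<alpha> g x)" if "g \<in> carrier G" for g
    using rwalk_path x V.element_image[OF that x] unfolding rwalk_def by auto
  have "(\<lambda>g. path x (\<alpha> g x)) ` Y \<subseteq> ?W"
    using walk F(3) by (fastforce simp: Y_def orbit_len_def A_def)
  moreover have "finite ?W" using fin by blast
  ultimately have "finite ((\<lambda>g. path x (\<alpha> g x)) ` Y)" using finite_subset by blast
  then obtain B where B: "B \<subseteq> Y" "finite B" "(\<lambda>g. path x (\<alpha> g x)) ` Y = (\<lambda>g. path x (\<alpha> g x)) ` B"
    using finite_subset_image[of "(\<lambda>g. path x (\<alpha> g x)) ` Y" "\<lambda>g. path x (\<alpha> g x)" Y] by auto
  have "\<exists>s\<in>B. orbit_len x (inv\<^bsub>G\<^esub> s \<otimes>\<^bsub>G\<^esub> g) = 0" if g: "g \<in> carrier G" "orbit_len x g \<le> r" for g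
  proof -
    have "g \<in> Y" using g by (simp add: Y_def)
    then obtain s where s: "s \<in> B" "path x (\<alpha> g x) = path x (\<alpha> s x)" using B(3) by blast
    have sG: "s \<in> carrier G" using s(1) B(1) by (auto simp: Y_def)
    have "longest_common_prefix p p = p" for p :: "'e list"
      by (induction p) auto
    then have "orbit_len x (inv\<^bsub>G\<^esub> s \<otimes>\<^bsub>G\<^esub> g) = 0"
      using orbit_len_formula[OF x sG g(1)] s(2) by (simp add: orbit_len_def)
    then show ?thesis using s(1) by blast
  qed
  then show ?thesis using B by (intro exI[of _ B]) (auto simp: Y_def)
qed

end

section \<open>Fixed subgroups of generalised Baumslag-Solitar groups\<close>

lemma (in tree_action) orbit_len_cyclic_length:
  assumes edge: "\<And>e. e \<in> arcs T \<Longrightarrow> infinite_cyclic (G\<lparr>carrier := stabilizer G \<beta> e\<rparr>)"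
    and vertex: "\<And>v. v \<in> verts T \<Longrightarrow> infinite_cyclic (G\<lparr>carrier := stabilizer G \<alpha> v\<rparr>)"
    and fg: "finitely_generated G" and x: "x \<in> verts T"
  obtains a where "cyclic_length G (orbit_len x) a"
proof -
  have S: "\<exists>S. finite S \<and> S \<subseteq> carrier G \<and> generate G S = carrier G"
    using fg by (simp add: finitely_generated_def)
  obtain a where a: "a \<in> stabilizer G \<alpha> x" "stabilizer G \<alpha> x = range (\<lambda>i::int. a [^]\<^bsub>G\<^esub> i)"
    "\<And>i::int. a [^]\<^bsub>G\<^esub> i = \<one>\<^bsub>G\<^esub> \<Longrightarrow> i = 0"
    using grp.infinite_cyclic_subgroupE[OF V.stabilizer_subgroup[OF x] vertex[OF x]] by metis
  interpret lyndon_length G "orbit_len x" by (rule orbit_len_lyndon[OF x])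
  have "cyclic_length G (orbit_len x) a"
  proof
    show "a \<in> carrier G" using a(1) by (simp add: stabilizer_def)
    show "orbit_len x g = 0 \<longleftrightarrow> g \<in> range (\<lambda>i::int. a [^]\<^bsub>G\<^esub> i)" if "g \<in> carrier G" for g
      using orbit_len_zero[OF x that] a(2) by simp
    show "i = 0" if "a [^]\<^bsub>G\<^esub> i = \<one>\<^bsub>G\<^esub>" for i :: int using a(3) that .
    show "\<exists>S. finite S \<and> S \<subseteq> carrier G \<and>
        (\<forall>g\<in>carrier G. orbit_len x g \<le> r \<longrightarrow> (\<exists>s\<in>S. orbit_len x (inv\<^bsub>G\<^esub> s \<otimes>\<^bsub>G\<^esub> g) = 0))" for r
      using orbit_len_balls[OF edge vertex x] S by blast
  qed (rule S)
  then show ?thesis using that by blast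
qed

lemma AutoGroup_pow:
  assumes \<phi>: "\<phi> \<in> carrier (AutoGroup G)" and g: "g \<in> carrier G"
  shows "(\<phi> [^]\<^bsub>AutoGroup G\<^esub> (k::nat)) g = (\<phi> ^^ k) g"
proof -
  have bij: "\<phi> \<in> Bij (carrier G)" using \<phi> by (simp add: AutoGroup_def auto_def)
  have "\<phi> [^]\<^bsub>AutoGroup G\<^esub> k \<in> Bij (carrier G) \<and>
      (\<forall>g\<in>carrier G. (\<phi> [^]\<^bsub>AutoGroup G\<^esub> k) g = (\<phi> ^^ k) g)"
  proof (induction k)
    case 0
    have "\<phi> [^]\<^bsub>AutoGroup G\<^esub> (0::nat) = (\<lambda>x\<in>carrier G. x)"
      by (simp add: AutoGroup_def BijGroup_def nat_pow_def)
    then show ?case using id_Bij[of "carrier G"] by (metis funpow_0 restrict_apply')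
  next
    case (Suc k)
    have "\<phi> [^]\<^bsub>AutoGroup G\<^esub> Suc k = (\<phi> [^]\<^bsub>AutoGroup G\<^esub> k) \<otimes>\<^bsub>AutoGroup G\<^esub> \<phi>"
      by (simp add: nat_pow_def)
    also have "\<dots> = compose (carrier G) (\<phi> [^]\<^bsub>AutoGroup G\<^esub> k) \<phi>"
      using Suc bij by (simp add: AutoGroup_def BijGroup_def)
    finally have eq: "\<phi> [^]\<^bsub>AutoGroup G\<^esub> Suc k = compose (carrier G) (\<phi> [^]\<^bsub>AutoGroup G\<^esub> k) \<phi>" .
    have "\<phi> g \<in> carrier G" if "g \<in> carrier G" for g
      using Bij_imp_funcset[OF bij] that by blast
    then show ?case
      unfolding eq using Suc bij compose_Bij by (auto simp: compose_eq funpow_swap1)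
  qed
  then show ?thesis using g by blast
qed

theorem theoremC:
  fixes G :: "('g, 'b) monoid_scheme" and \<phi> :: "'g \<Rightarrow> 'g"
  assumes "gbs_group TYPE('v) TYPE('e) G"
    and "\<phi> \<in> carrier (AutoGroup G)"
    and "\<exists>n::nat. n > 0 \<and> \<phi> [^]\<^bsub>AutoGroup G\<^esub> n = \<one>\<^bsub>AutoGroup G\<^esub>"
  shows "finitely_generated (G\<lparr>carrier := Fix G \<phi>\<rparr>)"
proof -
  obtain n :: nat where n: "n > 0" "\<phi> [^]\<^bsub>AutoGroup G\<^esub> n = \<one>\<^bsub>AutoGroup G\<^esub>"
    using assms(3) by blast
  have fg: "finitely_generated G" using assms(1) by (simp add: gbs_group_def)
  obtain T :: "('v, 'e) pre_digraph" and arev \<alpha> \<beta> where act: "tree_action G T arev \<alpha> \<beta>"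
    and vertex: "\<And>v. v \<in> verts T \<Longrightarrow> infinite_cyclic (G\<lparr>carrier := stabilizer G \<alpha> v\<rparr>)"
    and edge: "\<And>e. e \<in> arcs T \<Longrightarrow> infinite_cyclic (G\<lparr>carrier := stabilizer G \<beta> e\<rparr>)"
    using assms(1) unfolding gbs_group_def by blast
  interpret tree_action G T arev \<alpha> \<beta> by (rule act)
  obtain x where x: "x \<in> verts T"
    using connected unfolding connected_def strongly_connected_def by auto
  obtain a where a: "cyclic_length G (orbit_len x) a"
    using orbit_len_cyclic_length[OF edge vertex fg x] .
  interpret cyclic_length G "orbit_len x" a by (rule a)
  have "periodic_endomorphism G (orbit_len x) a \<phi> n"
  proof
    show "\<phi> \<in> hom G G" using assms(2) by (simp add: AutoGroup_def auto_def)
    show "n > 0" by (rule n(1))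
    show "(\<phi> ^^ n) g = g" if "g \<in> carrier G" for g
      using AutoGroup_pow[OF assms(2) that, of n] that
      by (simp add: n(2)) (simp add: AutoGroup_def BijGroup_def)
  qed
  then show ?thesis by (rule periodic_endomorphism.Fix_finitely_generated)
qed

end
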